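(* Let $\kappa$ be a singular cardinal with $\operatorname{cf}(\kappa)=\lambda$. If $\mathbb{P}$ is one of $\mathbb{M}_\kappa$, ${}^{\mathrm{scl}}\mathbb{M}_\kappa$, or $\mathbb{L}_\kappa$, then $\mathbb{P}$ is not countably distributive (i.e. not $\omega$-distributive: it adds a function from $\omega$ to the ordinals not in the ground model).
   Context: Fix a strictly increasing sequence $\langle\kappa_\alpha:\alpha<\lambda\rangle$ of regular infinite cardinals with supremum $\kappa$. Let $N=\bigcup_{\alpha<\lambda}\prod_{\beta<\alpha}\kappa_\beta$ (functions $t$ with $\mathrm{dom}(t)$ an ordinal $<\lambda$ and $t(\beta)<\kappa_\beta$), ordered by end-extension $\sqsubseteq$. A tree is a nonempty $T\subseteq N$ closed under initial segments; $\mathrm{Succ}_T(t)$ is the set of immediate successors of $t$ in $T$; $t$ is $\kappa_\alpha$-splitting if $|\mathrm{Succ}_T(t)|\ge\kappa_\alpha$. $T$ is $(<\lambda)$-closed if every node has a proper extension in $T$ and whenever $\delta<\lambda$ is a limit and $f$ has domain $\delta$ with $f\restriction\beta\in T$ for all $\beta<\delta$, then $f\in T$. $T$ is ever-branching if for all $s\in T$ and $\alpha<\lambda$ there is a $\kappa_\alpha$-splitting $t\in T$ with $s\sqsubseteq t$. $T$ is perfect if it is $(<\lambda)$-closed and ever-branching. $\mathbb{M}_\kappa$: perfect trees. ${}^{\mathrm{scl}}\mathbb{M}_\kappa$: perfect trees $p$ such that for every $\delta<\lambda$ and every $\sqsubseteq$-increasing sequence $\langle t_\alpha:\alpha<\delta\rangle$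 of nodes of $p$ with $t_\alpha$ $\kappa_\alpha$-splitting, the union $\bigcup_\alpha t_\alpha$ is a $\kappa_\delta$-splitting node of $p$. $\mathbb{L}_\kappa$: $(<\lambda)$-closed trees $p$ with a node $s$ (the stem) comparable with every node of $p$ such that every $t\in p$ with $s\sqsubseteq t$ satisfies $|\mathrm{Succ}_p(t)|=\kappa_{\mathrm{dom}(t)}$. All are ordered by inclusion.
   Formalization: In the definition of the splitting-closed Miller poset, the closure condition is required only for limit δ<λ; read literally for all δ, the cases δ=0 and δ=1 would force the root to be κ_1-splitting, which is impossible, so that poset would be empty. *)

theory Defs
  imports Main "HOL-Library.Equipollence"
begin

text \<open>Ordinals are the elements of an arbitrary well-ordered type \<open>'o\<close>; an ordinal \<open>\<alpha>\<close> is
  identified with its set of predecessors \<open>{..<\<alpha>}\<close>.\<close>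

definition is_limit :: "'o::wellorder \<Rightarrow> bool" where
  "is_limit \<delta> \<longleftrightarrow> {..<\<delta>} \<noteq> {} \<and> (\<forall>\<beta><\<delta>. \<exists>\<gamma><\<delta>. \<beta> < \<gamma>)"

definition inf_cardinal :: "'o::wellorder \<Rightarrow> bool" where
  "inf_cardinal \<mu> \<longleftrightarrow> infinite {..<\<mu>} \<and> (\<forall>\<beta><\<mu>. {..<\<beta>} \<prec> {..<\<mu>})"

definition cofinality :: "'o::wellorder \<Rightarrow> 'o" where
  "cofinality \<mu> = (LEAST \<gamma>. \<exists>f. f ` {..<\<gamma>} \<subseteq> {..<\<mu>} \<and> (\<forall>\<xi><\<mu>. \<exists>\<beta><\<gamma>. \<xi> \<le> f \<beta>))"

definition regular_cardinal :: "'o::wellorder \<Rightarrow> bool" where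
  "regular_cardinal \<mu> \<longleftrightarrow> inf_cardinal \<mu> \<and> cofinality \<mu> = \<mu>"

definition singular_cardinal :: "'o::wellorder \<Rightarrow> bool" where
  "singular_cardinal \<mu> \<longleftrightarrow> inf_cardinal \<mu> \<and> cofinality \<mu> < \<mu>"

text \<open>Below, \<open>ks\<close> is the sequence of the \<open>\<kappa>\<^sub>\<alpha>\<close> (only its values at \<open>\<alpha> < lam\<close> matter) and \<open>lam\<close>
  is its length. Nodes are partial functions whose domain is an ordinal, so end-extension
  is \<open>\<subseteq>\<^sub>m\<close>.\<close>

type_synonym 'o node = "'o \<rightharpoonup> 'o"

definition nodes :: "('o::wellorder \<Rightarrow> 'o) \<Rightarrow> 'o \<Rightarrow> 'o node set" where
  "nodes ks lam = {t. \<exists>\<alpha><lam. dom t = {..<\<alpha>} \<and> (\<forall>\<beta> \<xi>. t \<beta> = Some \<xi> \<longrightarrow> \<xi> < ks \<beta>)}"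

definition node_len :: "'o::wellorder node \<Rightarrow> 'o" where
  "node_len t = (THE \<alpha>. dom t = {..<\<alpha>})"

definition is_tree :: "('o::wellorder \<Rightarrow> 'o) \<Rightarrow> 'o \<Rightarrow> 'o node set \<Rightarrow> bool" where
  "is_tree ks lam T \<longleftrightarrow> T \<noteq> {} \<and> T \<subseteq> nodes ks lam \<and>
     (\<forall>t\<in>T. \<forall>s\<in>nodes ks lam. s \<subseteq>\<^sub>m t \<longrightarrow> s \<in> T)"

definition Succs :: "'o node set \<Rightarrow> 'o node \<Rightarrow> 'o node set" where
  "Succs T t = {s\<in>T. t \<subseteq>\<^sub>m s \<and> t \<noteq> s \<and> (\<forall>u\<in>T. t \<subseteq>\<^sub>m u \<and> u \<subseteq>\<^sub>m s \<longrightarrow> u = t \<or> u = s)}"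

definition splitting :: "'o::wellorder \<Rightarrow> 'o node set \<Rightarrow> 'o node \<Rightarrow> bool" where
  "splitting \<mu> T t \<longleftrightarrow> t \<in> T \<and> {..<\<mu>} \<lesssim> Succs T t"

definition lt_closed :: "'o::wellorder \<Rightarrow> 'o node set \<Rightarrow> bool" where
  "lt_closed lam T \<longleftrightarrow>
     (\<forall>t\<in>T. \<exists>s\<in>T. t \<subseteq>\<^sub>m s \<and> t \<noteq> s) \<and>
     (\<forall>\<delta><lam. is_limit \<delta> \<longrightarrow>
        (\<forall>f. dom f = {..<\<delta>} \<and> (\<forall>\<beta><\<delta>. f |` {..<\<beta>} \<in> T) \<longrightarrow> f \<in> T))"

definition ever_branching :: "('o::wellorder \<Rightarrow> 'o) \<Rightarrow> 'o \<Rightarrow> 'o node set \<Rightarrow> bool" where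
  "ever_branching ks lam T \<longleftrightarrow>
     (\<forall>s\<in>T. \<forall>\<alpha><lam. \<exists>t\<in>T. splitting (ks \<alpha>) T t \<and> s \<subseteq>\<^sub>m t)"

definition Miller :: "('o::wellorder \<Rightarrow> 'o) \<Rightarrow> 'o \<Rightarrow> 'o node set set" where
  "Miller ks lam = {p. is_tree ks lam p \<and> lt_closed lam p \<and> ever_branching ks lam p}"

text \<open>The splitting-closure condition is imposed at limit \<open>\<delta>\<close>. For \<open>\<delta> = 0\<close> it would make the
  root \<open>\<kappa>\<^sub>0\<close>-splitting, and then for \<open>\<delta> = 1\<close> it would make the root \<open>\<kappa>\<^sub>1\<close>-splitting, although the
  root has at most \<open>\<kappa>\<^sub>0\<close> immediate successors.\<close>

definition scl_Miller :: "('o::wellorder \<Rightarrow> 'o) \<Rightarrow> 'o \<Rightarrow> 'o node set set" where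
  "scl_Miller ks lam = {p \<in> Miller ks lam.
     \<forall>\<delta><lam. is_limit \<delta> \<longrightarrow>
       (\<forall>t :: 'o \<Rightarrow> 'o node.
          (\<forall>\<alpha><\<delta>. splitting (ks \<alpha>) p (t \<alpha>)) \<and> (\<forall>\<beta><\<delta>. \<forall>\<alpha>\<le>\<beta>. t \<alpha> \<subseteq>\<^sub>m t \<beta>) \<longrightarrow>
          (\<exists>u. Map.graph u = (\<Union>\<alpha>\<in>{..<\<delta>}. Map.graph (t \<alpha>)) \<and> splitting (ks \<delta>) p u))}"

definition Laver :: "('o::wellorder \<Rightarrow> 'o) \<Rightarrow> 'o \<Rightarrow> 'o node set set" where
  "Laver ks lam = {p. is_tree ks lam p \<and> lt_closed lam p \<and>
     (\<exists>s\<in>p. (\<forall>t\<in>p. s \<subseteq>\<^sub>m t \<or> t \<subseteq>\<^sub>m s) \<and>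
            (\<forall>t\<in>p. s \<subseteq>\<^sub>m t \<longrightarrow> Succs p t \<approx> {..<ks (node_len t)}))}"

text \<open>A forcing notion is a set \<open>P\<close> of conditions with an order \<open>le\<close>, where \<open>le q p\<close> means that
  \<open>q\<close> is stronger than \<open>p\<close>.\<close>

definition open_dense :: "'p set \<Rightarrow> ('p \<Rightarrow> 'p \<Rightarrow> bool) \<Rightarrow> 'p set \<Rightarrow> bool" where
  "open_dense P le D \<longleftrightarrow> D \<subseteq> P \<and> (\<forall>p\<in>P. \<exists>q\<in>D. le q p) \<and> (\<forall>p\<in>D. \<forall>q\<in>P. le q p \<longrightarrow> q \<in> D)"

definition countably_distributive :: "'p set \<Rightarrow> ('p \<Rightarrow> 'p \<Rightarrow> bool) \<Rightarrow> bool" where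
  "countably_distributive P le \<longleftrightarrow>
     (\<forall>D :: nat \<Rightarrow> 'p set. (\<forall>n. open_dense P le (D n)) \<longrightarrow> open_dense P le (\<Inter>n. D n))"

text \<open>A name for a subset of \<open>\<omega> \<times> V\<close> is a set \<open>\<tau>\<close> of triples \<open>(s, n, x)\<close>; its value in an
  extension by a generic \<open>G\<close> is the set of all \<open>(n, x)\<close> with \<open>(s, n, x) \<in> \<tau>\<close> for some \<open>s \<in> G\<close>.
  The three predicates below are the forcing relation for the statements
  \<open>(n, x) \<in> \<tau>\<close>, ``\<open>\<tau>\<close> is a function with domain \<open>\<omega>\<close>'' and ``\<open>\<tau>\<close> is not a function of the ground
  model''.\<close>

definition forces_mem ::
    "'p set \<Rightarrow> ('p \<Rightarrow> 'p \<Rightarrow> bool) \<Rightarrow> 'p \<Rightarrow> nat \<Rightarrow> 'v \<Rightarrow> ('p \<times> nat \<times> 'v) set \<Rightarrow> bool" where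
  "forces_mem P le p n x \<tau> \<longleftrightarrow>
     (\<forall>q\<in>P. le q p \<longrightarrow> (\<exists>r\<in>P. le r q \<and> (\<exists>s. (s, n, x) \<in> \<tau> \<and> le r s)))"

definition forces_function ::
    "'p set \<Rightarrow> ('p \<Rightarrow> 'p \<Rightarrow> bool) \<Rightarrow> 'p \<Rightarrow> ('p \<times> nat \<times> 'v) set \<Rightarrow> bool" where
  "forces_function P le p \<tau> \<longleftrightarrow>
     (\<forall>n. \<forall>q\<in>P. le q p \<longrightarrow>
        (\<exists>r\<in>P. le r q \<and> (\<exists>x. forces_mem P le r n x \<tau>)) \<and>
        (\<forall>x y. forces_mem P le q n x \<tau> \<and> forces_mem P le q n y \<tau> \<longrightarrow> x = y))"

definition forces_new ::
    "'p set \<Rightarrow> ('p \<Rightarrow> 'p \<Rightarrow> bool) \<Rightarrow> 'p \<Rightarrow> ('p \<times> nat \<times> 'v) set \<Rightarrow> bool" where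
  "forces_new P le p \<tau> \<longleftrightarrow>
     (\<forall>g :: nat \<Rightarrow> 'v. \<forall>q\<in>P. le q p \<longrightarrow> \<not> (\<forall>n. forces_mem P le q n (g n) \<tau>))"

text \<open>The values of the new function are taken in the type of conditions, which by choice is in
  bijection with an ordinal. This loses no functions into the ordinals: a name for the value
  at \<open>n\<close> is decided by a maximal antichain, hence has at most \<open>|P|\<close> possible values.\<close>

definition adds_new_omega_sequence :: "'p set \<Rightarrow> ('p \<Rightarrow> 'p \<Rightarrow> bool) \<Rightarrow> bool" where
  "adds_new_omega_sequence P le \<longleftrightarrow>
     (\<exists>\<tau> :: ('p \<times> nat \<times> 'p) set. fst ` \<tau> \<subseteq> P \<and>
        (\<forall>p\<in>P. forces_function P le p \<tau> \<and> forces_new P le p \<tau>))"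

end

theory Submission imports Defs begin

text \<open>
  Call a map \<open>r\<close> with \<open>r p \<subseteq> p\<close> on conditions a winning strategy if no sequence
  \<open>p\<^sub>0 \<supseteq> r p\<^sub>0 \<supseteq> p\<^sub>1 \<supseteq> r p\<^sub>1 \<supseteq> \<dots>\<close> has a lower bound. Given one, choose maximal antichains \<open>A\<^sub>n\<close> such that
  every element of \<open>A\<^sub>n\<^sub>+\<^sub>1\<close> is \<open>r p\<close> for some \<open>p\<close> below an element of \<open>A\<^sub>n\<close>. No condition lies below
  an element of every \<open>A\<^sub>n\<close>, and the sequence of the elements of \<open>A\<^sub>n\<close> in the generic filter is new.

  For the tree forcings, \<open>r p\<close> keeps at each infinitely splitting node only the successors whose
  position in the increasing enumeration of all successors is a successor ordinal. This preserves
  the number of successors, but no successor survives infinitely many such steps, as its position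
  drops each time.

  For Laver trees this is all. For Miller trees the pruning might destroy all the highly splitting
  nodes above a given node, so \<open>p\<close> is thinned out simultaneously: along each branch the splitting
  nodes that are kept are counted, and the node with count \<open>\<xi>\<close> is required to be \<open>\<kappa>\<^sub>\<xi>\<close>-splitting; from
  all other nodes only the path to a fixed \<open>\<kappa>\<^sub>\<xi>\<close>-splitting node is kept. By regularity of \<open>\<lambda>\<close> the
  counts are unbounded on every branch.
\<close>

section \<open>Strategies against distributivity\<close>

definition compatible :: "'a set set \<Rightarrow> 'a set \<Rightarrow> 'a set \<Rightarrow> bool" where
  "compatible P p q \<longleftrightarrow> (\<exists>r\<in>P. r \<subseteq> p \<and> r \<subseteq> q)"

definition antichain :: "'a set set \<Rightarrow> 'a set set \<Rightarrow> bool" where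
  "antichain P A \<longleftrightarrow> (\<forall>a\<in>A. \<forall>b\<in>A. compatible P a b \<longrightarrow> a = b)"

text \<open>Zorn's lemma yields an antichain \<open>M\<close> that is maximal only among the subsets
  of \<open>E\<close>. Density makes it maximal in \<open>P\<close>: if \<open>p\<close> were
  incompatible with all of \<open>M\<close>, some \<open>e \<in> E\<close> below \<open>p\<close>
  could be added to \<open>M\<close>.\<close>

lemma maximal_antichain_exists:
  assumes EP: "E \<subseteq> P" and dense: "\<And>p. p \<in> P \<Longrightarrow> \<exists>e\<in>E. e \<subseteq> p"
  shows "\<exists>A\<subseteq>E. antichain P A \<and> (\<forall>p\<in>P. \<exists>a\<in>A. compatible P p a)"
proof -
  let ?S = "{X. X \<subseteq> E \<and> antichain P X}"
  have "\<exists>M\<in>?S. \<forall>X\<in>?S. M \<subseteq> X \<longrightarrow> X = M"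
  proof (rule subset_Zorn')
    fix C assume C: "subset.chain ?S C"
    have "antichain P (\<Union>C)"
      unfolding antichain_def
    proof (intro ballI impI)
      fix a b assume "a \<in> \<Union>C" "b \<in> \<Union>C" and ab: "compatible P a b"
      then obtain X Y where XY: "a \<in> X" "X \<in> C" "b \<in> Y" "Y \<in> C" by blast
      with C have "X \<subseteq> Y \<or> Y \<subseteq> X" "X \<in> ?S" "Y \<in> ?S"
        by (auto simp: subset_chain_def)
      with XY ab show "a = b" unfolding antichain_def mem_Collect_eq by blast
    qed
    moreover have "\<Union>C \<subseteq> E" using C by (auto simp: subset_chain_def)
    ultimately show "\<Union>C \<in> ?S" by simp
  qed
  then obtain M where M: "M \<subseteq> E" "antichain P M"
    and max: "\<And>X. X \<subseteq> E \<Longrightarrow> antichain P X \<Longrightarrow> M \<subseteq> X \<Longrightarrow> X = M"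
    by auto
  have "\<exists>a\<in>M. compatible P p a" if p: "p \<in> P" for p
  proof (rule ccontr)
    assume no: "\<not> ?thesis"
    obtain e where e: "e \<in> E" "e \<subseteq> p" using dense[OF p] by blast
    have e_no: "\<not> compatible P e a" "\<not> compatible P a e" if "a \<in> M" for a
      using no that e by (auto simp: compatible_def)
    have "antichain P (insert e M)"
      using M(2) e_no by (auto simp: antichain_def)
    then have "insert e M = M" using max[of "insert e M"] M e by auto
    moreover have "compatible P e e" using e EP by (auto simp: compatible_def)
    ultimately show False using e_no by blast
  qed
  with M show ?thesis by blast
qed

text \<open>The refining antichains give both conclusions: their downward closures are open dense
  with empty intersection, and the sequence of their generic members is new. The hypothesis
  \<open>separative\<close> serves the second conclusion: a condition deciding the sequence as
  \<open>g\<close> is at first only hereditarily compatible with each \<open>g n\<close>, and must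
  be brought below it.\<close>

lemma not_distributive_if_strategy:
  fixes P :: "'a set set" and r :: "'a set \<Rightarrow> 'a set"
  assumes ne: "P \<noteq> {}"
    and r_mem: "\<And>p. p \<in> P \<Longrightarrow> r p \<in> P"
    and r_sub: "\<And>p. p \<in> P \<Longrightarrow> r p \<subseteq> p"
    and no_bound: "\<And>(p :: nat \<Rightarrow> 'a set) q. (\<And>n. p n \<in> P) \<Longrightarrow> (\<And>n. p (Suc n) \<subseteq> r (p n)) \<Longrightarrow> q \<in> P
        \<Longrightarrow> (\<And>n. q \<subseteq> p n) \<Longrightarrow> False"
    and separative: "\<And>q a. q \<in> P \<Longrightarrow> a \<in> P \<Longrightarrow> (\<And>s. s \<in> P \<Longrightarrow> s \<subseteq> q \<Longrightarrow> compatible P s a) \<Longrightarrow> q \<subseteq> a"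
  shows "\<not> countably_distributive P (\<subseteq>) \<and> adds_new_omega_sequence P (\<subseteq>)"
proof -
  \<comment> \<open>\<open>?E A\<close> collects the answers of the strategy to conditions below
    members of \<open>A\<close>. It is dense when \<open>A\<close> is a maximal antichain.\<close>
  let ?E = "\<lambda>A. {r p |p. p \<in> P \<and> (\<exists>a\<in>A. p \<subseteq> a)}"
  define good where "good A \<longleftrightarrow> A \<subseteq> P \<and> antichain P A \<and> (\<forall>p\<in>P. \<exists>a\<in>A. compatible P p a)" for A
  have "\<exists>A. \<forall>n::nat. good (A n) \<and> A (Suc n) \<subseteq> ?E (A n)"
  proof (rule dependent_nat_choice)
    show "\<exists>A. good A" using maximal_antichain_exists[of P P] by (auto simp: good_def)
  next
    fix A :: "'a set set" and n :: nat assume A: "good A"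
    have "\<exists>e\<in>?E A. e \<subseteq> p" if p: "p \<in> P" for p
    proof -
      obtain a c where "a \<in> A" "c \<in> P" "c \<subseteq> p" "c \<subseteq> a"
        using A p unfolding good_def compatible_def by blast
      then have "r c \<in> ?E A" "r c \<subseteq> p" using r_sub by blast+
      then show ?thesis by blast
    qed
    note dense = this
    have EP: "?E A \<subseteq> P" using r_mem by auto
    have "\<exists>B\<subseteq>?E A. antichain P B \<and> (\<forall>p\<in>P. \<exists>a\<in>B. compatible P p a)"
      by (rule maximal_antichain_exists[OF EP]) (rule dense)
    then obtain B where B: "B \<subseteq> ?E A" "antichain P B" "\<forall>p\<in>P. \<exists>a\<in>B. compatible P p a"
      by (elim exE conjE)
    have "B \<subseteq> P" using B(1) EP by (rule order_trans)
    with B have "good B" by (simp only: good_def simp_thms)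
    with B(1) show "\<exists>B. good B \<and> B \<subseteq> ?E A" by (intro exI[of _ B] conjI)
  qed
  then obtain A :: "nat \<Rightarrow> 'a set set" where good_step: "\<forall>n. good (A n) \<and> A (Suc n) \<subseteq> ?E (A n)"
    by (rule exE)
  have A: "good (A n)" and step: "A (Suc n) \<subseteq> ?E (A n)" for n
    using good_step by simp_all
  have AP: "A n \<subseteq> P" for n using A[of n] by (simp add: good_def)
  have anti: "a = b" if "a \<in> A n" "b \<in> A n" "compatible P a b" for a b n
    using A[of n] that by (auto simp: good_def antichain_def)
  have pre: "\<exists>a\<in>A n. compatible P p a" if "p \<in> P" for p n
    using A[of n] that by (auto simp: good_def)
  \<comment> \<open>A lower bound \<open>q\<close> of a choice \<open>g\<close> through all
    \<open>A n\<close> determines the history: \<open>g (Suc n)\<close> is the answer to some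
    \<open>p\<close> below a member of \<open>A n\<close>, and that member is \<open>g n\<close>
    because \<open>q\<close> lies below both. So these \<open>p\<close> form a run with lower bound
    \<open>q\<close>.\<close>
  have empty: False if q: "q \<in> P" and g: "\<And>n. g n \<in> A n" "\<And>n. q \<subseteq> g n" for q g
  proof -
    have "\<exists>p\<in>P. g (Suc n) = r p \<and> p \<subseteq> g n" for n
    proof -
      obtain p a where p: "p \<in> P" "g (Suc n) = r p" "a \<in> A n" "p \<subseteq> a"
        using step[of n] g(1)[of "Suc n"] by auto
      have "q \<subseteq> a" using g(2)[of "Suc n"] p r_sub[OF p(1)] by auto
      then have "compatible P a (g n)" using q g(2)[of n] by (auto simp: compatible_def)
      then have "a = g n" using anti p(3) g(1) by blast
      with p show ?thesis by blast
    qed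
    then obtain p where p: "\<And>n. p n \<in> P" "\<And>n. g (Suc n) = r (p n)" "\<And>n. p n \<subseteq> g n" by metis
    show False
    proof (rule no_bound[of p q])
      show "p (Suc n) \<subseteq> r (p n)" for n using p(2)[of n] p(3)[of "Suc n"] by simp
      show "q \<subseteq> p n" for n using g(2)[of "Suc n"] p(2)[of n] r_sub[OF p(1)[of n]] by auto
    qed (use p q in auto)
  qed
  define D where "D n = {p\<in>P. \<exists>a\<in>A n. p \<subseteq> a}" for n
  have "open_dense P (\<subseteq>) (D n)" for n
    unfolding open_dense_def
  proof (intro conjI ballI impI)
    fix p assume "p \<in> P"
    from pre[OF this, of n] show "\<exists>q\<in>D n. q \<subseteq> p" by (auto simp: D_def compatible_def)
  qed (auto simp: D_def)
  moreover have "(\<Inter>n. D n) = {}"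
  proof (rule ccontr)
    assume "\<not> ?thesis"
    then obtain q where q: "\<And>n. q \<in> D n" by blast
    then have "\<forall>n. \<exists>a. a \<in> A n \<and> q \<subseteq> a" by (auto simp: D_def)
    then obtain g where "\<And>n. g n \<in> A n" "\<And>n. q \<subseteq> g n" by metis
    with empty[of q g] q[of 0] show False by (auto simp: D_def)
  qed
  moreover have "\<not> open_dense P (\<subseteq>) {}" using ne by (auto simp: open_dense_def)
  ultimately have nd: "\<not> countably_distributive P (\<subseteq>)"
    unfolding countably_distributive_def by (auto intro!: exI[of _ D])
  \<comment> \<open>The value at \<open>n\<close> is to be the member of \<open>A n\<close> in the
    generic filter, so each condition \<open>s\<close> is also the value that it announces.\<close>
  define \<tau> where "\<tau> = {(s, n, x). s \<in> A n \<and> x = s}"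
  have fm: "forces_mem P (\<subseteq>) q n x \<tau> \<longleftrightarrow> (\<forall>s\<in>P. s \<subseteq> q \<longrightarrow> x \<in> A n \<and> compatible P s x)" for q n x
  proof -
    have "(\<exists>s. (s, n, x) \<in> \<tau> \<and> c \<subseteq> s) \<longleftrightarrow> x \<in> A n \<and> c \<subseteq> x" for c by (auto simp: \<tau>_def)
    then have "(\<exists>c\<in>P. c \<subseteq> d \<and> (\<exists>s. (s, n, x) \<in> \<tau> \<and> c \<subseteq> s)) \<longleftrightarrow> x \<in> A n \<and> compatible P d x" for d
      unfolding compatible_def by metis
    then show ?thesis unfolding forces_mem_def by simp
  qed
  have "forces_function P (\<subseteq>) p \<tau>" for p
    unfolding forces_function_def
  proof (intro allI ballI impI conjI)
    fix n q assume q: "q \<in> P" "q \<subseteq> p"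
    obtain a c where "a \<in> A n" "c \<in> P" "c \<subseteq> q" "c \<subseteq> a"
      using pre[OF q(1), of n] by (auto simp: compatible_def)
    then have "forces_mem P (\<subseteq>) c n a \<tau>"
      unfolding fm compatible_def by (meson order_refl order_trans)
    then show "\<exists>s\<in>P. s \<subseteq> q \<and> (\<exists>x. forces_mem P (\<subseteq>) s n x \<tau>)"
      using \<open>c \<in> P\<close> \<open>c \<subseteq> q\<close> by metis
  next
    fix n q x y assume q: "q \<in> P" "q \<subseteq> p"
      and xy: "forces_mem P (\<subseteq>) q n x \<tau> \<and> forces_mem P (\<subseteq>) q n y \<tau>"
    then have "x \<in> A n" "compatible P q x" unfolding fm by auto
    then obtain s where "s \<in> P" "s \<subseteq> q" "s \<subseteq> x" by (auto simp: compatible_def)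
    with xy have "y \<in> A n" "compatible P s y" unfolding fm by auto
    \<comment> \<open>The common extension of \<open>s\<close> and \<open>y\<close> is below
      \<open>x\<close> as well, so it links two members of the same antichain.\<close>
    with \<open>s \<subseteq> x\<close> have "compatible P x y" unfolding compatible_def by (meson order_trans)
    then show "x = y" using anti \<open>x \<in> A n\<close> \<open>y \<in> A n\<close> by blast
  qed
  moreover have "forces_new P (\<subseteq>) p \<tau>" for p
    unfolding forces_new_def
  proof (intro allI ballI impI notI)
    fix g q assume q: "q \<in> P" "q \<subseteq> p" and g: "\<forall>n. forces_mem P (\<subseteq>) q n (g n) \<tau>"
    then have fg: "g n \<in> A n \<and> compatible P s (g n)" if "s \<in> P" "s \<subseteq> q" for n s
      using that unfolding fm by simp
    then have gA: "g n \<in> A n" for n using q(1) by simp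
    have "q \<subseteq> g n" for n
    proof (rule separative)
      show "g n \<in> P" using gA AP by (rule set_rev_mp)
    qed (use q fg in simp_all)
    with gA show False by (rule empty[OF q(1)])
  qed
  moreover have "fst ` \<tau> \<subseteq> P" using AP by (auto simp: \<tau>_def subset_iff)
  ultimately have "adds_new_omega_sequence P (\<subseteq>)"
    unfolding adds_new_omega_sequence_def by (intro exI[of _ \<tau>]) simp
  with nd show ?thesis by (rule conjI)
qed

section \<open>Successor positions in a set of ordinals\<close>

text \<open>The \<open>y\<close> in the body is the immediate predecessor of \<open>x\<close> within
  \<open>A\<close>. Thus "successor position" is expressed without an enumeration of
  \<open>A\<close> or its order type.\<close>

definition shrink :: "'o::wellorder set \<Rightarrow> 'o set" where
  "shrink A = {x\<in>A. \<exists>y\<in>A. y < x \<and> (\<forall>z\<in>A. z < x \<longrightarrow> z \<le> y)}"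

lemma shrink_subset: "shrink A \<subseteq> A"
  by (auto simp: shrink_def)

text \<open>The map \<open>nxt\<close> to the next element of \<open>A\<close> is a bijection from
  the non-maximal elements onto \<open>shrink A\<close>. At most one element of \<open>A\<close> is
  maximal, and removing it from an infinite set does not change the cardinality.\<close>

lemma shrink_eqpoll:
  assumes "infinite A"
  shows "shrink A \<approx> A"
proof -
  define B where "B = {y\<in>A. \<exists>x\<in>A. y < x}"
  define nxt where "nxt y = (LEAST x. x \<in> A \<and> y < x)" for y
  have nxt: "nxt y \<in> A \<and> y < nxt y" if "y \<in> B" for y
    unfolding nxt_def using that LeastI_ex[of "\<lambda>x. x \<in> A \<and> y < x"] by (auto simp: B_def)
  have nxt_le: "nxt y \<le> x" if "x \<in> A" "y < x" for x y
    unfolding nxt_def using that by (simp add: Least_le)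
  have "inj_on nxt B"
  proof (rule inj_onI)
    fix a b assume ab: "a \<in> B" "b \<in> B" "nxt a = nxt b"
    then have "\<not> a < b" "\<not> b < a"
      using nxt[of a] nxt[of b] nxt_le[of b a] nxt_le[of a b] by (auto simp: B_def)
    then show "a = b" by simp
  qed
  moreover have "nxt ` B = shrink A"
  proof
    show "nxt ` B \<subseteq> shrink A"
    proof clarify
      fix y assume y: "y \<in> B"
      then have "z \<le> y" if "z \<in> A" "z < nxt y" for z
        using nxt_le[of z y] that by (meson leD leI)
      with nxt[OF y] y show "nxt y \<in> shrink A" by (auto simp: shrink_def B_def)
    qed
    show "shrink A \<subseteq> nxt ` B"
    proof
      fix x assume "x \<in> shrink A"
      then obtain y where y: "x \<in> A" "y \<in> A" "y < x" "\<And>z. z \<in> A \<Longrightarrow> z < x \<Longrightarrow> z \<le> y"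
        by (auto simp: shrink_def)
      then have "y \<in> B" by (auto simp: B_def)
      moreover have "nxt y = x"
        using nxt[OF \<open>y \<in> B\<close>] nxt_le[of x y] y by (metis leD order_le_imp_less_or_eq)
      ultimately show "x \<in> nxt ` B" by blast
    qed
  qed
  ultimately have "B \<approx> shrink A"
    unfolding eqpoll_def bij_betw_def by blast
  moreover have "B \<approx> A"
  proof (cases "B = A")
    case False
    then obtain m where m: "m \<in> A" "m \<notin> B" by (auto simp: B_def)
    then have "x \<in> B" if "x \<in> A" "x \<noteq> m" for x
      using that unfolding B_def by (metis (mono_tags, lifting) linorder_neqE mem_Collect_eq)
    with m have "A = insert m B" by (auto simp: B_def)
    moreover have "infinite B" using assms calculation by (metis finite_insert)
    ultimately show ?thesis
      using infinite_insert_eqpoll eqpoll_sym by metis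
  qed simp
  ultimately show ?thesis using eqpoll_sym eqpoll_trans by blast
qed

text \<open>Suppose \<open>x\<close> is the least point of the intersection. Its predecessor
  \<open>y n\<close> in \<open>A n\<close> cannot increase as the sets decrease, hence is eventually
  a constant \<open>v\<close>. Then \<open>v\<close> lies in every \<open>A n\<close> although
  \<open>v < x\<close>.\<close>

lemma shrink_sequence_Inter_empty:
  fixes A :: "nat \<Rightarrow> 'o::wellorder set"
  assumes step: "\<And>n. A (Suc n) \<subseteq> shrink (A n)"
  shows "(\<Inter>n. A n) = {}"
proof (rule ccontr)
  assume "(\<Inter>n. A n) \<noteq> {}"
  then obtain x0 where x0: "x0 \<in> (\<Inter>n. A n)" by blast
  define x where "x = (LEAST x. x \<in> (\<Inter>n. A n))"
  have x: "x \<in> A n" for n using LeastI[of "\<lambda>x. x \<in> (\<Inter>n. A n)", OF x0] by (auto simp: x_def)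
  have x_le: "x \<le> y" if "\<And>n. y \<in> A n" for y unfolding x_def using that by (intro Least_le) auto
  have "x \<in> shrink (A n)" for n using step x by blast
  then have "\<forall>n. \<exists>y. y \<in> A n \<and> y < x \<and> (\<forall>z\<in>A n. z < x \<longrightarrow> z \<le> y)" by (auto simp: shrink_def)
  then obtain y where y: "\<And>n. y n \<in> A n" "\<And>n. y n < x"
    and y_max: "\<And>n z. z \<in> A n \<Longrightarrow> z < x \<Longrightarrow> z \<le> y n" by metis
  have dec: "A n \<subseteq> A m" if "m \<le> n" for m n
    using that by (rule lift_Suc_antimono_le[rotated]) (use step shrink_subset in blast)
  have y_dec: "y n \<le> y m" if "m \<le> n" for m n
    using y_max y dec[OF that] by blast
  define v where "v = (LEAST v. v \<in> range y)"
  have "v \<in> range y" unfolding v_def by (rule LeastI) (rule rangeI)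
  then obtain N where N: "y N = v" by blast
  have v: "v \<le> y n" for n unfolding v_def by (simp add: Least_le)
  have "y n = v" if "N \<le> n" for n using y_dec[OF that] v[of n] N by simp
  then have "v \<in> A n" for n
    using y(1)[of "max N n"] dec[of n "max N n"] by auto
  then have "x \<le> v" using x_le by blast
  with y(2)[of N] N show False by simp
qed

section \<open>Nodes and trees\<close>

text \<open>The type may have a largest element, where this \<open>LEAST\<close> is unspecified.
  Hence the facts about \<open>osuc \<gamma>\<close> assume an element above
  \<open>\<gamma>\<close>, which every \<open>\<gamma> < lam\<close> has.\<close>

definition osuc :: "'o::wellorder \<Rightarrow> 'o" where
  "osuc \<gamma> = (LEAST \<alpha>. \<gamma> < \<alpha>)"

lemma osuc_facts:
  assumes "\<gamma> < (\<alpha>::'o::wellorder)"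
  shows "\<gamma> < osuc \<gamma>" "osuc \<gamma> \<le> \<alpha>" "{..<osuc \<gamma>} = insert \<gamma> {..<\<gamma>}"
proof -
  show 1: "\<gamma> < osuc \<gamma>" unfolding osuc_def by (rule LeastI[of _ \<alpha>]) (rule assms)
  show "osuc \<gamma> \<le> \<alpha>" unfolding osuc_def by (rule Least_le) (rule assms)
  have "\<beta> \<le> \<gamma>" if "\<beta> < osuc \<gamma>" for \<beta>
    using that unfolding osuc_def by (meson leI not_less_Least)
  with 1 show "{..<osuc \<gamma>} = insert \<gamma> {..<\<gamma>}"
    by (auto simp: order_le_less)
qed

lemma node_len_eq: "dom t = {..<\<alpha>} \<Longrightarrow> node_len t = \<alpha>"
  unfolding node_len_def by (rule the_equality) auto

lemma map_le_restrict_eq: "s \<subseteq>\<^sub>m t \<Longrightarrow> dom s = X \<Longrightarrow> s = t |` X"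
  by (rule ext) (auto simp: map_le_def restrict_map_def dom_def)

lemma restrict_map_le: "t |` X \<subseteq>\<^sub>m t"
  by (auto simp: map_le_def)

lemma restrict_mono_le: "X \<subseteq> Y \<Longrightarrow> t |` X \<subseteq>\<^sub>m t |` Y"
  by (auto simp: map_le_def restrict_map_def)

lemma chain_union:
  assumes C: "\<And>x y. x \<in> C \<Longrightarrow> y \<in> C \<Longrightarrow> x \<subseteq>\<^sub>m y \<or> y \<subseteq>\<^sub>m x"
  obtains b where "\<forall>x\<in>C. x \<subseteq>\<^sub>m b" "dom b = (\<Union>x\<in>C. dom x)"
proof -
  \<comment> \<open>Any member of the chain that is defined at a point may supply the value there,
    since comparable maps agree on common points.\<close>
  define b where "b \<beta> = (if \<exists>x\<in>C. \<beta> \<in> dom x then (SOME x. x \<in> C \<and> \<beta> \<in> dom x) \<beta> else None)" for \<beta>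
  have xb: "x \<subseteq>\<^sub>m b" if x: "x \<in> C" for x
    unfolding map_le_def
  proof
    fix \<beta> assume \<beta>: "\<beta> \<in> dom x"
    define y where "y = (SOME x. x \<in> C \<and> \<beta> \<in> dom x)"
    have y: "y \<in> C \<and> \<beta> \<in> dom y" unfolding y_def by (rule someI[of _ x]) (use x \<beta> in simp)
    then have "x \<beta> = y \<beta>" using C[of x y] x \<beta> unfolding map_le_def by metis
    moreover have "b \<beta> = y \<beta>" unfolding b_def y_def using x \<beta> by auto
    ultimately show "x \<beta> = b \<beta>" by simp
  qed
  then have "\<forall>x\<in>C. x \<subseteq>\<^sub>m b" by simp
  moreover have "dom b = (\<Union>x\<in>C. dom x)"
  proof
    show "dom b \<subseteq> (\<Union>x\<in>C. dom x)" by (auto simp: b_def split: if_splits)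
    show "(\<Union>x\<in>C. dom x) \<subseteq> dom b" using xb map_le_implies_dom_le by blast
  qed
  ultimately show thesis by (rule that)
qed

text \<open>Immediate successors are replaced by the ordinals that name them, so that
  \<open>shrink\<close> applies and the successor sets of one node can be compared across
  trees.\<close>

definition vals :: "'o::wellorder node set \<Rightarrow> 'o node \<Rightarrow> 'o set" where
  "vals p t = {\<xi>. t(node_len t \<mapsto> \<xi>) \<in> p}"

text \<open>The restriction is tested at every position of \<open>s\<close> against the initial
  segment below it, so closure under initial segments is inherited from \<open>p\<close> whatever
  \<open>R\<close> is.\<close>

definition prune :: "'o::wellorder node set \<Rightarrow> ('o node \<Rightarrow> 'o set) \<Rightarrow> 'o node set" where
  "prune p R = {s\<in>p. \<forall>\<beta> \<xi>. s \<beta> = Some \<xi> \<longrightarrow> \<xi> \<in> R (s |` {..<\<beta>})}"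

definition through :: "'o node set \<Rightarrow> 'o node \<Rightarrow> 'o node set" where
  "through p t = {s\<in>p. s \<subseteq>\<^sub>m t \<or> t \<subseteq>\<^sub>m s}"

text \<open>\<open>lam_regular\<close> is regularity of \<open>lam\<close> in the form in which it
  is applied to lengths and positions: a family of ordinals below \<open>lam\<close>, indexed by
  some \<open>\<delta> < lam\<close>, has a strict bound below \<open>lam\<close>.\<close>

locale cardinal_sequence =
  fixes ks :: "'o::wellorder \<Rightarrow> 'o" and lam :: 'o
  assumes ks_cardinal: "\<alpha> < lam \<Longrightarrow> inf_cardinal (ks \<alpha>)"
    and ks_strict_mono: "\<alpha> < \<beta> \<Longrightarrow> \<beta> < lam \<Longrightarrow> ks \<alpha> < ks \<beta>"
    and lam_limit: "is_limit lam"
    and lam_regular: "\<delta> < lam \<Longrightarrow> (\<And>i. i < \<delta> \<Longrightarrow> f i < lam) \<Longrightarrow> \<exists>\<beta><lam. \<forall>i<\<delta>. f i < \<beta>"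
begin

lemma ks_mono: "\<alpha> \<le> \<beta> \<Longrightarrow> \<beta> < lam \<Longrightarrow> ks \<alpha> \<le> ks \<beta>"
  using ks_strict_mono[of \<alpha> \<beta>] by (auto simp: order_le_less)

lemma infinite_ks: "\<alpha> < lam \<Longrightarrow> infinite {..<ks \<alpha>}"
  using ks_cardinal by (auto simp: inf_cardinal_def)

text \<open>Each \<open>ks \<alpha>\<close> is an initial ordinal, so a larger value never injects
  into a smaller one, and comparing cardinalities amounts to comparing indices.\<close>

lemma ks_lepoll_iff:
  assumes "\<alpha> < lam" "\<beta> < lam"
  shows "{..<ks \<alpha>} \<lesssim> {..<ks \<beta>} \<longleftrightarrow> \<alpha> \<le> \<beta>"
proof
  assume le: "{..<ks \<alpha>} \<lesssim> {..<ks \<beta>}"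
  show "\<alpha> \<le> \<beta>"
  proof (rule ccontr)
    assume "\<not> \<alpha> \<le> \<beta>"
    then have "ks \<beta> < ks \<alpha>" using ks_strict_mono assms by auto
    then have "{..<ks \<beta>} \<prec> {..<ks \<alpha>}" using ks_cardinal assms by (auto simp: inf_cardinal_def)
    with le show False by (metis lesspoll_def lepoll_antisym eqpoll_sym)
  qed
next
  assume "\<alpha> \<le> \<beta>"
  then show "{..<ks \<alpha>} \<lesssim> {..<ks \<beta>}"
    using ks_mono assms by (intro subset_imp_lepoll) auto
qed

lemma osuc_less_lam: "\<gamma> < lam \<Longrightarrow> osuc \<gamma> < lam"
  using lam_limit osuc_facts(2) unfolding is_limit_def by (meson order_le_less_trans)

lemma lam_pos: obtains \<alpha> where "\<alpha> < lam"
  using lam_limit by (auto simp: is_limit_def)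

lemma nodesD:
  assumes "t \<in> nodes ks lam"
  shows "dom t = {..<node_len t}" "node_len t < lam" "t \<beta> = Some \<xi> \<Longrightarrow> \<xi> < ks \<beta>"
proof -
  obtain \<alpha> where "\<alpha> < lam" "dom t = {..<\<alpha>}" using assms by (auto simp: nodes_def)
  moreover from this have "node_len t = \<alpha>" by (simp add: node_len_eq)
  ultimately show "dom t = {..<node_len t}" "node_len t < lam" by simp_all
  show "t \<beta> = Some \<xi> \<Longrightarrow> \<xi> < ks \<beta>" using assms by (auto simp: nodes_def)
qed

lemma dom_restrict_branch:
  assumes "dom b = {..<\<gamma>}" "\<beta> \<le> \<gamma>"
  shows "dom (b |` {..<\<beta>}) = {..<\<beta>}" "node_len (b |` {..<\<beta>}) = \<beta>"
proof -
  show "dom (b |` {..<\<beta>}) = {..<\<beta>}" using assms by auto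
  then show "node_len (b |` {..<\<beta>}) = \<beta>" by (rule node_len_eq)
qed

lemma restrict_len: "t \<in> nodes ks lam \<Longrightarrow> t |` {..<node_len t} = t"
  using nodesD(1)[of t] by (metis map_le_refl map_le_restrict_eq)

lemma restrict_ge_len: "t \<in> nodes ks lam \<Longrightarrow> node_len t \<le> \<beta> \<Longrightarrow> t |` {..<\<beta>} = t"
proof (rule ext)
  fix x assume "t \<in> nodes ks lam" "node_len t \<le> \<beta>"
  then have "x < \<beta>" if "x \<in> dom t" using that nodesD(1)[of t] by auto
  then show "(t |` {..<\<beta>}) x = t x" by (cases "t x") (auto simp: restrict_map_def)
qed

lemma restrict_nodes:
  assumes "t \<in> nodes ks lam"
  shows "t |` {..<\<beta>} \<in> nodes ks lam"
proof (cases "\<beta> \<le> node_len t")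
  case True
  then have "dom (t |` {..<\<beta>}) = {..<\<beta>}" using nodesD(1)[OF assms] dom_restrict_branch by blast
  moreover have "\<beta> < lam" using True nodesD(2)[OF assms] by simp
  ultimately show ?thesis using nodesD(3)[OF assms] unfolding nodes_def
    by (auto simp: restrict_map_def split: if_splits)
next
  case False
  then show ?thesis using restrict_ge_len[OF assms] assms by simp
qed

lemma map_le_len:
  assumes "s \<in> nodes ks lam" "t \<in> nodes ks lam" "s \<subseteq>\<^sub>m t"
  shows "node_len s \<le> node_len t" "s = t |` {..<node_len s}"
proof -
  have "dom s \<subseteq> dom t" using assms(3) by (rule map_le_implies_dom_le)
  then show "node_len s \<le> node_len t" using nodesD(1) assms by (metis lessThan_subset_iff)
  show "s = t |` {..<node_len s}" using map_le_restrict_eq assms nodesD(1) by blast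
qed

lemma map_le_len_eq:
  assumes "s \<in> nodes ks lam" "t \<in> nodes ks lam" "s \<subseteq>\<^sub>m t" "node_len s = node_len t"
  shows "s = t"
  using map_le_len(2)[OF assms(1-3)] assms(4) restrict_len[OF assms(2)] by simp

lemma map_le_total:
  assumes "s \<in> nodes ks lam" "t \<in> nodes ks lam" "s \<subseteq>\<^sub>m b" "t \<subseteq>\<^sub>m b" "node_len s \<le> node_len t"
  shows "s \<subseteq>\<^sub>m t"
proof -
  have "s = b |` {..<node_len s}" "t = b |` {..<node_len t}"
    using assms nodesD(1) map_le_restrict_eq by blast+
  then show ?thesis using restrict_mono_le[of "{..<node_len s}" "{..<node_len t}" b] assms(5) by auto
qed

lemma dom_extend:
  assumes "t \<in> nodes ks lam"
  shows "dom (t(node_len t \<mapsto> \<xi>)) = {..<osuc (node_len t)}"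
    "node_len (t(node_len t \<mapsto> \<xi>)) = osuc (node_len t)"
    "t \<subseteq>\<^sub>m t(node_len t \<mapsto> \<xi>)" "t \<noteq> t(node_len t \<mapsto> \<xi>)"
    "t(node_len t \<mapsto> \<xi>) |` {..<node_len t} = t"
proof -
  show 1: "dom (t(node_len t \<mapsto> \<xi>)) = {..<osuc (node_len t)}"
    using nodesD[OF assms] osuc_facts(3)[of "node_len t" lam] by simp
  then show "node_len (t(node_len t \<mapsto> \<xi>)) = osuc (node_len t)" by (rule node_len_eq)
  have n: "t (node_len t) = None" using nodesD(1)[OF assms] by (auto simp: dom_def)
  then show "t \<subseteq>\<^sub>m t(node_len t \<mapsto> \<xi>)" by (auto simp: map_le_def dom_def)
  show "t \<noteq> t(node_len t \<mapsto> \<xi>)" using n by (metis fun_upd_same option.distinct(1))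
  show "t(node_len t \<mapsto> \<xi>) |` {..<node_len t} = t"
    using map_le_restrict_eq[OF \<open>t \<subseteq>\<^sub>m t(node_len t \<mapsto> \<xi>)\<close> nodesD(1)[OF assms]] by simp
qed

lemma restrict_osuc:
  assumes "dom b = {..<\<gamma>}" "\<beta> < \<gamma>" "b \<beta> = Some \<xi>"
  shows "b |` {..<osuc \<beta>} = (b |` {..<\<beta>})(\<beta> \<mapsto> \<xi>)"
  using assms osuc_facts(3)[OF assms(2)] by (auto simp: restrict_map_def fun_eq_iff)

lemma treeD:
  assumes "is_tree ks lam T"
  shows "T \<noteq> {}" "T \<subseteq> nodes ks lam" "t \<in> T \<Longrightarrow> t \<in> nodes ks lam"
    "t \<in> T \<Longrightarrow> s \<in> nodes ks lam \<Longrightarrow> s \<subseteq>\<^sub>m t \<Longrightarrow> s \<in> T"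
    "t \<in> T \<Longrightarrow> t |` {..<\<beta>} \<in> T"
  using assms restrict_nodes restrict_map_le unfolding is_tree_def by blast+

text \<open>A proper extension of \<open>t\<close> is defined at \<open>node_len t\<close>, and
  closure under initial segments puts its restriction to \<open>osuc (node_len t)\<close> in
  \<open>T\<close>. So every proper extension passes through a one-step extension.\<close>

lemma succ_in_vals:
  assumes T: "is_tree ks lam T" and ts: "t \<in> nodes ks lam" "s \<in> T" "t \<subseteq>\<^sub>m s" "t \<noteq> s"
  obtains \<xi> where "s (node_len t) = Some \<xi>" "\<xi> \<in> vals T t" "t(node_len t \<mapsto> \<xi>) \<subseteq>\<^sub>m s"
proof -
  have s: "s \<in> nodes ks lam" using treeD(3)[OF T ts(2)] .
  have less: "node_len t < node_len s"
    using map_le_len(1)[OF ts(1) s ts(3)] map_le_len_eq[OF ts(1) s ts(3)] ts(4) by force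
  then obtain \<xi> where \<xi>: "s (node_len t) = Some \<xi>"
    using nodesD(1)[OF s] by (auto simp: dom_def set_eq_iff)
  have "s |` {..<osuc (node_len t)} = t(node_len t \<mapsto> \<xi>)"
    using restrict_osuc[OF nodesD(1)[OF s] less \<xi>] map_le_len(2)[OF ts(1) s ts(3)] by simp
  moreover have "s |` {..<osuc (node_len t)} \<in> T" using treeD(5)[OF T ts(2)] .
  ultimately show thesis using that[OF \<xi>] restrict_map_le[of s] unfolding vals_def by (metis mem_Collect_eq)
qed

text \<open>\<open>Succs\<close> refers only to the order of the tree, while pruning works with
  values. The two match because a proper extension of \<open>t\<close> contains a one-step extension
  lying in \<open>T\<close>, so nothing longer can be immediate.\<close>

lemma Succs_eq:
  assumes T: "is_tree ks lam T" and t: "t \<in> T"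
  shows "Succs T t = (\<lambda>\<xi>. t(node_len t \<mapsto> \<xi>)) ` vals T t"
proof
  have tn: "t \<in> nodes ks lam" using treeD(3)[OF T t] .
  show "Succs T t \<subseteq> (\<lambda>\<xi>. t(node_len t \<mapsto> \<xi>)) ` vals T t"
  proof
    fix s assume s: "s \<in> Succs T t"
    then obtain \<xi> where \<xi>: "\<xi> \<in> vals T t" "t(node_len t \<mapsto> \<xi>) \<subseteq>\<^sub>m s"
      using succ_in_vals[OF T tn, of s] by (auto simp: Succs_def)
    have "t(node_len t \<mapsto> \<xi>) \<in> T" using \<xi>(1) by (simp add: vals_def)
    then have "t(node_len t \<mapsto> \<xi>) = t \<or> t(node_len t \<mapsto> \<xi>) = s"
      using s dom_extend(3)[OF tn, of \<xi>] \<xi>(2) by (simp add: Succs_def)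
    then have "t(node_len t \<mapsto> \<xi>) = s" using dom_extend(4)[OF tn, of \<xi>] by simp
    with \<xi> show "s \<in> (\<lambda>\<xi>. t(node_len t \<mapsto> \<xi>)) ` vals T t" by blast
  qed
  show "(\<lambda>\<xi>. t(node_len t \<mapsto> \<xi>)) ` vals T t \<subseteq> Succs T t"
  proof clarify
    fix \<xi> assume \<xi>: "\<xi> \<in> vals T t"
    let ?s = "t(node_len t \<mapsto> \<xi>)"
    have "u = t \<or> u = ?s" if u: "u \<in> T" "t \<subseteq>\<^sub>m u" "u \<subseteq>\<^sub>m ?s" for u
    proof (cases "u = t")
      case False
      obtain \<eta> where \<eta>: "t(node_len t \<mapsto> \<eta>) \<subseteq>\<^sub>m u" using succ_in_vals[OF T tn u(1,2)] False by blast
      then have "dom u = dom ?s"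
        using u(3) dom_extend(1)[OF tn] by (metis map_le_implies_dom_le subset_antisym)
      with u(3) show ?thesis by (metis map_le_antisym map_le_def)
    qed simp
    then show "?s \<in> Succs T t"
      using \<xi> dom_extend(3,4)[OF tn, of \<xi>] unfolding Succs_def vals_def by simp
  qed
qed

lemma Succs_eqpoll:
  assumes "is_tree ks lam T" "t \<in> T"
  shows "Succs T t \<approx> vals T t"
  unfolding Succs_eq[OF assms]
  by (rule inj_on_image_eqpoll_self) (auto simp: inj_on_def dest: map_upd_eqD1)

lemma splitting_iff:
  assumes "is_tree ks lam T"
  shows "splitting \<mu> T t \<longleftrightarrow> t \<in> T \<and> {..<\<mu>} \<lesssim> vals T t"
  unfolding splitting_def using Succs_eqpoll[OF assms]
  by (meson eqpoll_imp_lepoll eqpoll_sym lepoll_trans)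

lemma lt_closed_iff:
  assumes T: "is_tree ks lam T"
  shows "lt_closed lam T \<longleftrightarrow> (\<forall>t\<in>T. vals T t \<noteq> {}) \<and>
     (\<forall>\<delta><lam. is_limit \<delta> \<longrightarrow> (\<forall>f. dom f = {..<\<delta>} \<and> (\<forall>\<beta><\<delta>. f |` {..<\<beta>} \<in> T) \<longrightarrow> f \<in> T))"
proof -
  have "(\<exists>s\<in>T. t \<subseteq>\<^sub>m s \<and> t \<noteq> s) \<longleftrightarrow> vals T t \<noteq> {}" if t: "t \<in> T" for t
  proof
    assume "\<exists>s\<in>T. t \<subseteq>\<^sub>m s \<and> t \<noteq> s"
    then obtain s where s: "s \<in> T" "t \<subseteq>\<^sub>m s" "t \<noteq> s" by auto
    obtain \<xi> where "\<xi> \<in> vals T t" by (rule succ_in_vals[OF T treeD(3)[OF T t] s])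
    then show "vals T t \<noteq> {}" by blast
  next
    assume "vals T t \<noteq> {}"
    then obtain \<xi> where "t(node_len t \<mapsto> \<xi>) \<in> T" by (auto simp: vals_def)
    then show "\<exists>s\<in>T. t \<subseteq>\<^sub>m s \<and> t \<noteq> s"
      using dom_extend(3,4)[OF treeD(3)[OF T t], of \<xi>] by (intro bexI conjI)
  qed
  then have "(\<forall>t\<in>T. \<exists>s\<in>T. t \<subseteq>\<^sub>m s \<and> t \<noteq> s) \<longleftrightarrow> (\<forall>t\<in>T. vals T t \<noteq> {})" by simp
  then show ?thesis unfolding lt_closed_def by (simp only:)
qed

text \<open>The branch is the union of a maximal chain of nodes through \<open>s\<close>. Since
  nodes have proper extensions, the chain has no last member. If its lengths were bounded below
  \<open>lam\<close>, the union would have limit length, belong to \<open>T\<close> by closure, and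
  be such a last member.\<close>

lemma branch_exists:
  assumes T: "is_tree ks lam T" and cl: "lt_closed lam T" and s: "s \<in> T"
  obtains b where "dom b = {..<lam}" "s \<subseteq>\<^sub>m b" "\<And>\<beta>. \<beta> < lam \<Longrightarrow> b |` {..<\<beta>} \<in> T"
proof -
  let ?ch = "\<lambda>C. C \<subseteq> T \<and> s \<in> C \<and> (\<forall>x\<in>C. \<forall>y\<in>C. x \<subseteq>\<^sub>m y \<or> y \<subseteq>\<^sub>m x)"
  define S where "S = {C. ?ch C}"
  have S: "C \<in> S \<longleftrightarrow> ?ch C" for C unfolding S_def by (rule mem_Collect_eq)
  have "\<exists>M\<in>S. \<forall>X\<in>S. M \<subseteq> X \<longrightarrow> X = M"
  proof (rule subset_Zorn_nonempty)
    have "{s} \<in> S" unfolding S using s by simp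
    then show "S \<noteq> {}" by blast
    fix \<C> assume ne: "\<C> \<noteq> {}" and ch: "subset.chain S \<C>"
    have "\<C> \<subseteq> S" using ch by (simp add: subset_chain_def)
    have \<C>: "?ch C" if "C \<in> \<C>" for C using subsetD[OF \<open>\<C> \<subseteq> S\<close> that] unfolding S .
    have "x \<subseteq>\<^sub>m y \<or> y \<subseteq>\<^sub>m x" if xy: "x \<in> \<Union>\<C>" "y \<in> \<Union>\<C>" for x y
    proof -
      obtain X Y where XY: "x \<in> X" "X \<in> \<C>" "y \<in> Y" "Y \<in> \<C>" using xy by blast
      have Z: ?thesis if "Z \<in> \<C>" "x \<in> Z" "y \<in> Z" for Z
        using \<C>[OF that(1)] that(2,3) by (elim conjE) (drule (1) bspec, drule (1) bspec)
      have "X \<subseteq> Y \<or> Y \<subseteq> X" using ch XY(2,4) unfolding subset_chain_def by blast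
      then show ?thesis
      proof
        assume "X \<subseteq> Y"
        then show ?thesis using Z[OF XY(4) subsetD XY(3)] XY(1) by blast
      next
        assume "Y \<subseteq> X"
        then show ?thesis using Z[OF XY(2) XY(1) subsetD] XY(3) by blast
      qed
    qed
    moreover have "\<Union>\<C> \<subseteq> T" using \<C> by (simp add: Sup_le_iff)
    moreover obtain C where "C \<in> \<C>" using ne by blast
    then have "s \<in> \<Union>\<C>" using \<C>[of C] by auto
    ultimately show "\<Union>\<C> \<in> S" unfolding S by simp
  qed
  then obtain C where CS: "C \<in> S" and max': "\<forall>X\<in>S. C \<subseteq> X \<longrightarrow> X = C" by (rule bexE)
  have C: "C \<subseteq> T" "s \<in> C" "\<And>x y. x \<in> C \<Longrightarrow> y \<in> C \<Longrightarrow> x \<subseteq>\<^sub>m y \<or> y \<subseteq>\<^sub>m x"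
    using CS unfolding S by simp_all
  have max: "X = C" if "?ch X" "C \<subseteq> X" for X
    using max' that S[of X] by simp
  have Cn: "x \<in> nodes ks lam" if "x \<in> C" for x using that C(1) treeD(2)[OF T] by blast
  have add: "x \<in> C" if x: "x \<in> T" "\<And>y. y \<in> C \<Longrightarrow> y \<subseteq>\<^sub>m x" for x
  proof -
    have "insert x C = C" by (rule max) (use x C in auto)
    then show ?thesis by blast
  qed
  have no_max: "\<exists>y\<in>C. \<not> y \<subseteq>\<^sub>m x" if x: "x \<in> C" for x
  proof (rule ccontr)
    assume "\<not> ?thesis"
    then have all: "\<And>y. y \<in> C \<Longrightarrow> y \<subseteq>\<^sub>m x" by blast
    obtain z where z: "z \<in> T" "x \<subseteq>\<^sub>m z" "x \<noteq> z" using cl x C(1) unfolding lt_closed_def by blast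
    then have "z \<in> C" using add[of z] all map_le_trans by blast
    then show False using all z by (meson map_le_antisym)
  qed
  obtain b where b: "\<forall>x\<in>C. x \<subseteq>\<^sub>m b" and db: "dom b = (\<Union>x\<in>C. dom x)"
    using C(3) by (rule chain_union)
  have xb: "x \<subseteq>\<^sub>m b" if "x \<in> C" for x using b that by (rule bspec)
  have longer: "\<exists>y\<in>C. node_len x < node_len y" if x: "x \<in> C" for x
  proof -
    obtain y where "y \<in> C" "\<not> y \<subseteq>\<^sub>m x" using no_max x by blast
    then show ?thesis using map_le_total[OF Cn Cn xb xb] x by (meson leI)
  qed
  have restr: "b |` {..<\<beta>} \<in> T" if x: "x \<in> C" "\<beta> \<le> node_len x" for x \<beta>
  proof -
    have "b |` {..<\<beta>} = x |` {..<\<beta>}"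
    proof (rule ext)
      fix \<gamma>
      have "\<gamma> \<in> dom x" if "\<gamma> < \<beta>" using that x(2) nodesD(1)[OF Cn[OF x(1)]] by simp
      then show "(b |` {..<\<beta>}) \<gamma> = (x |` {..<\<beta>}) \<gamma>"
        using xb[OF x(1)] by (simp add: restrict_map_def map_le_def)
    qed
    then show ?thesis using treeD(5)[OF T] C(1) x by auto
  qed
  have unb: "\<exists>x\<in>C. \<alpha> < node_len x" if \<alpha>: "\<alpha> < lam" for \<alpha>
  proof (rule ccontr)
    assume "\<not> ?thesis"
    then have bd: "\<forall>x\<in>C. node_len x \<le> \<alpha>" by (meson leI)
    \<comment> \<open>\<open>\<delta>\<close> is the supremum of the lengths. No member attains it,
      because every member is exceeded by a longer one; hence \<open>\<delta>\<close> is a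
      limit.\<close>
    define \<delta> where "\<delta> = (LEAST \<delta>. \<forall>x\<in>C. node_len x \<le> \<delta>)"
    have \<delta>: "node_len x \<le> \<delta>" if "x \<in> C" for x
      using LeastI[of "\<lambda>\<delta>. \<forall>x\<in>C. node_len x \<le> \<delta>", OF bd] that unfolding \<delta>_def by blast
    have "\<delta> \<le> \<alpha>" unfolding \<delta>_def by (rule Least_le) (rule bd)
    then have \<delta>_lam: "\<delta> < lam" using \<alpha> by simp
    have less: "node_len x < \<delta>" if "x \<in> C" for x using longer[OF that] \<delta> by (meson order_less_le_trans)
    have sup: "\<exists>x\<in>C. \<beta> < node_len x" if "\<beta> < \<delta>" for \<beta>
      using not_less_Least[OF that[unfolded \<delta>_def]] by (meson leI)
    have "dom b = {..<\<delta>}"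
    proof -
      have "(\<Union>x\<in>C. dom x) = (\<Union>x\<in>C. {..<node_len x})" using nodesD(1)[OF Cn] by (rule SUP_cong[OF refl])
      also have "\<dots> = {..<\<delta>}" using sup less by (auto intro: order_less_trans)
      finally show ?thesis unfolding db .
    qed
    moreover have "is_limit \<delta>"
      unfolding is_limit_def using less[OF C(2)] sup less by blast
    moreover have "b |` {..<\<beta>} \<in> T" if "\<beta> < \<delta>" for \<beta>
      using sup[OF that] restr by (meson less_imp_le)
    ultimately have "b \<in> T" using cl \<delta>_lam unfolding lt_closed_def by blast
    then have "b \<in> C" using add xb by blast
    then show False using no_max xb by blast
  qed
  show thesis
  proof
    show "dom b = {..<lam}"
    proof -
      have "(\<Union>x\<in>C. dom x) = (\<Union>x\<in>C. {..<node_len x})" using nodesD(1)[OF Cn] by (rule SUP_cong[OF refl])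
      also have "\<dots> = {..<lam}" using unb nodesD(2)[OF Cn] by (auto intro: order_less_trans)
      finally show ?thesis unfolding db .
    qed
    show "s \<subseteq>\<^sub>m b" using xb C(2) .
    show "b |` {..<\<beta>} \<in> T" if "\<beta> < lam" for \<beta> using unb[OF that] restr by (meson less_imp_le)
  qed
qed

section \<open>Subtrees obtained by pruning and by passing through a node\<close>

lemma empty_node: "Map.empty \<in> nodes ks lam"
proof -
  define z :: 'o where "z = (LEAST x. True)"
  have z: "z \<le> x" for x unfolding z_def by (simp add: Least_le)
  have "{..<z} = {}" using z by (auto simp: not_less[symmetric])
  moreover obtain \<alpha> where "\<alpha> < lam" by (rule lam_pos)
  then have "z < lam" using z[of \<alpha>] by simp
  ultimately show ?thesis unfolding nodes_def by (auto intro!: exI[of _ z])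
qed

lemma empty_in_tree:
  assumes T: "is_tree ks lam T"
  shows "Map.empty \<in> T"
proof -
  obtain t where "t \<in> T" using treeD(1)[OF T] by blast
  then show ?thesis using treeD(4)[OF T _ empty_node] by simp
qed

lemma restrict_eq_below:
  assumes "s \<in> nodes ks lam" "s \<subseteq>\<^sub>m t" "\<beta> \<le> node_len s"
  shows "s |` {..<\<beta>} = t |` {..<\<beta>}"
proof (rule ext)
  fix \<gamma>
  have "\<gamma> \<in> dom s" if "\<gamma> < \<beta>" using that assms(3) nodesD(1)[OF assms(1)] by simp
  then show "(s |` {..<\<beta>}) \<gamma> = (t |` {..<\<beta>}) \<gamma>"
    using assms(2) by (simp add: restrict_map_def map_le_def)
qed

lemma less_len: "s \<in> nodes ks lam \<Longrightarrow> s \<beta> = Some \<xi> \<Longrightarrow> \<beta> < node_len s"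
  using nodesD(1)[of s] by (auto simp: dom_def set_eq_iff)

text \<open>Nonempty \<open>R t\<close> keeps every surviving node extendible, and a one-step
  extension of a surviving node meets only one new requirement. Limits are harmless because each
  requirement concerns a single position.\<close>

lemma prune_tree:
  assumes T: "is_tree ks lam T" and cl: "lt_closed lam T"
    and R: "\<forall>t\<in>T. R t \<subseteq> vals T t \<and> R t \<noteq> {}"
  shows "is_tree ks lam (prune T R)" "lt_closed lam (prune T R)"
    "\<And>t. t \<in> prune T R \<Longrightarrow> vals (prune T R) t = R t"
proof -
  have sub: "prune T R \<subseteq> T" by (auto simp: prune_def)
  show tree: "is_tree ks lam (prune T R)"
    unfolding is_tree_def
  proof (intro conjI ballI impI)
    have "Map.empty \<in> prune T R" using empty_in_tree[OF T] by (simp add: prune_def)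
    then show "prune T R \<noteq> {}" by blast
    show "prune T R \<subseteq> nodes ks lam" using sub treeD(2)[OF T] by (rule order_trans)
    fix t s assume t: "t \<in> prune T R" and s: "s \<in> nodes ks lam" "s \<subseteq>\<^sub>m t"
    have "s \<in> T" using treeD(4)[OF T _ s] t sub by auto
    moreover have "\<xi> \<in> R (s |` {..<\<beta>})" if \<beta>: "s \<beta> = Some \<xi>" for \<beta> \<xi>
    proof -
      have "t \<beta> = Some \<xi>" using s(2) \<beta> unfolding map_le_def by (metis domI)
      then have "\<xi> \<in> R (t |` {..<\<beta>})" using t by (simp add: prune_def)
      then show ?thesis using restrict_eq_below[OF s, of \<beta>] less_len[OF s(1) \<beta>] by simp
    qed
    ultimately show "s \<in> prune T R" by (simp add: prune_def)
  qed
  show v: "vals (prune T R) t = R t" if t: "t \<in> prune T R" for t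
  proof (rule set_eqI)
    fix \<xi>
    let ?s = "t(node_len t \<mapsto> \<xi>)"
    have tT: "t \<in> T" using t sub by auto
    have tn: "t \<in> nodes ks lam" using treeD(3)[OF T tT] .
    have "?s \<in> prune T R \<longleftrightarrow> \<xi> \<in> R t"
    proof
      assume "?s \<in> prune T R"
      then have "\<forall>\<beta> \<eta>. ?s \<beta> = Some \<eta> \<longrightarrow> \<eta> \<in> R (?s |` {..<\<beta>})"
        unfolding prune_def mem_Collect_eq by (rule conjunct2)
      from this[rule_format, of "node_len t" \<xi>]
      have "\<xi> \<in> R (?s |` {..<node_len t})" by (simp del: restrict_fun_upd)
      then show "\<xi> \<in> R t" using dom_extend(5)[OF tn, of \<xi>] by simp
    next
      assume \<xi>: "\<xi> \<in> R t"
      then have "?s \<in> T" using R tT by (auto simp: vals_def)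
      moreover have "\<eta> \<in> R (?s |` {..<\<beta>})" if \<eta>: "?s \<beta> = Some \<eta>" for \<beta> \<eta>
      proof (cases "\<beta> = node_len t")
        case True
        then show ?thesis using \<eta> \<xi> dom_extend(5)[OF tn, of \<xi>] by simp
      next
        case False
        then have "t \<beta> = Some \<eta>" using \<eta> by simp
        from less_len[OF tn this] have "t |` {..<\<beta>} = ?s |` {..<\<beta>}"
          by (intro restrict_eq_below[OF tn dom_extend(3)[OF tn]] less_imp_le)
        moreover have "\<eta> \<in> R (t |` {..<\<beta>})" using t \<open>t \<beta> = Some \<eta>\<close> by (simp add: prune_def)
        ultimately show ?thesis by (simp only:)
      qed
      ultimately show "?s \<in> prune T R" by (simp add: prune_def)
    qed
    then show "\<xi> \<in> vals (prune T R) t \<longleftrightarrow> \<xi> \<in> R t" by (simp add: vals_def)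
  qed
  show "lt_closed lam (prune T R)"
    unfolding lt_closed_iff[OF tree]
  proof (intro conjI ballI allI impI; (elim conjE)?)
    fix t assume "t \<in> prune T R"
    then show "vals (prune T R) t \<noteq> {}" using v R sub by auto
  next
    fix \<delta> f assume \<delta>: "\<delta> < lam" "is_limit \<delta>" and f: "dom f = {..<\<delta>}" "\<forall>\<beta><\<delta>. f |` {..<\<beta>} \<in> prune T R"
    have "f \<in> T" using cl \<delta> f sub unfolding lt_closed_def by (meson subsetD)
    moreover have "\<xi> \<in> R (f |` {..<\<beta>})" if \<xi>: "f \<beta> = Some \<xi>" for \<beta> \<xi>
    proof -
      have "\<beta> < \<delta>" using f(1) \<xi> by auto
      \<comment> \<open>Since \<open>\<delta>\<close> is a limit, the position
        \<open>\<beta>\<close> already belongs to a proper initial segment of \<open>f\<close>,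
        where the requirement is known.\<close>
      then obtain \<gamma> where \<gamma>: "\<gamma> < \<delta>" "\<beta> < \<gamma>" using \<delta>(2) by (auto simp: is_limit_def)
      then have "f |` {..<\<gamma>} \<in> prune T R" "(f |` {..<\<gamma>}) \<beta> = Some \<xi>" using f(2) \<xi> by simp_all
      then have "\<xi> \<in> R ((f |` {..<\<gamma>}) |` {..<\<beta>})" unfolding prune_def by blast
      moreover have "{..<\<gamma>} \<inter> {..<\<beta>} = {..<\<beta>}" using \<gamma>(2) by auto
      ultimately show ?thesis by simp
    qed
    ultimately show "f \<in> prune T R" by (simp add: prune_def)
  qed
qed

text \<open>Above \<open>t\<close> nothing changes, and below \<open>t\<close> only the path to it
  remains. The last claim locates infinite splitting: a node with infinitely many successors must
  extend \<open>t\<close>.\<close>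

lemma through_tree:
  assumes T: "is_tree ks lam T" and cl: "lt_closed lam T" and t: "t \<in> T"
  shows "is_tree ks lam (through T t)" "lt_closed lam (through T t)" "t \<in> through T t"
    "\<And>s. s \<in> T \<Longrightarrow> t \<subseteq>\<^sub>m s \<Longrightarrow> vals (through T t) s = vals T s"
    "\<And>s. s \<in> through T t \<Longrightarrow> \<not> t \<subseteq>\<^sub>m s \<Longrightarrow> finite (vals (through T t) s)"
proof -
  have sub: "through T t \<subseteq> T" by (auto simp: through_def)
  have tn: "t \<in> nodes ks lam" using treeD(3)[OF T t] .
  show tt: "t \<in> through T t" using t by (simp add: through_def)
  show tree: "is_tree ks lam (through T t)"
    unfolding is_tree_def
  proof (intro conjI ballI impI)
    show "through T t \<noteq> {}" using tt by blast
    show "through T t \<subseteq> nodes ks lam" using sub treeD(2)[OF T] by (rule order_trans)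
    fix u s assume u: "u \<in> through T t" and s: "s \<in> nodes ks lam" "s \<subseteq>\<^sub>m u"
    have "s \<in> T" using treeD(4)[OF T _ s] u sub by auto
    moreover have "s \<subseteq>\<^sub>m t \<or> t \<subseteq>\<^sub>m s"
    proof (cases "u \<subseteq>\<^sub>m t")
      case True
      then show ?thesis using s map_le_trans by metis
    next
      case False
      then have "t \<subseteq>\<^sub>m u" using u by (simp add: through_def)
      then show ?thesis using map_le_total[OF s(1) tn s(2)] map_le_total[OF tn s(1) _ s(2)]
        by (meson linear)
    qed
    ultimately show "s \<in> through T t" by (simp add: through_def)
  qed
  show above: "vals (through T t) s = vals T s" if s: "s \<in> T" "t \<subseteq>\<^sub>m s" for s
    using map_le_trans[OF s(2) dom_extend(3)[OF treeD(3)[OF T s(1)]]]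
    by (simp add: vals_def through_def)
  show "finite (vals (through T t) s)" if s: "s \<in> through T t" "\<not> t \<subseteq>\<^sub>m s" for s
  proof -
    have sn: "s \<in> nodes ks lam" using treeD(3)[OF tree s(1)] .
    have st: "s \<subseteq>\<^sub>m t" using s by (simp add: through_def)
    have len: "node_len s < node_len t"
      using map_le_len(1)[OF sn tn st] map_le_len_eq[OF sn tn st] s(2) by (force simp: order_le_less)
    \<comment> \<open>A one-step extension of \<open>s\<close> is no longer than \<open>t\<close>,
      so comparability puts it below \<open>t\<close>, and its last value is read off from
      \<open>t\<close>.\<close>
    have "\<xi> = the (t (node_len s))" if \<xi>: "\<xi> \<in> vals (through T t) s" for \<xi>
    proof -
      let ?u = "s(node_len s \<mapsto> \<xi>)"
      have u: "?u \<in> through T t" using \<xi> by (simp add: vals_def)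
      have un: "?u \<in> nodes ks lam" using treeD(3)[OF tree u] .
      have "node_len ?u \<le> node_len t" using dom_extend(2)[OF sn] osuc_facts(2)[OF len] by simp
      moreover have "?u \<subseteq>\<^sub>m t \<or> t \<subseteq>\<^sub>m ?u" using u by (simp add: through_def)
      ultimately have "?u \<subseteq>\<^sub>m t"
        using map_le_total[OF un tn map_le_refl, of] map_le_len_eq[OF tn un] map_le_len(1)[OF tn un] by force
      then show ?thesis unfolding map_le_def by (metis domI fun_upd_same option.sel)
    qed
    then have "vals (through T t) s \<subseteq> {the (t (node_len s))}" by blast
    then show ?thesis by (rule finite_subset) simp
  qed
  show "lt_closed lam (through T t)"
    unfolding lt_closed_iff[OF tree]
  proof (intro conjI ballI allI impI; (elim conjE)?)
    fix s assume s: "s \<in> through T t"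
    show "vals (through T t) s \<noteq> {}"
    proof (cases "t \<subseteq>\<^sub>m s")
      case True
      then show ?thesis using above cl s sub unfolding lt_closed_iff[OF T] by auto
    next
      case False
      then have st: "s \<subseteq>\<^sub>m t" "s \<noteq> t" using s by (auto simp: through_def)
      obtain \<xi> where "\<xi> \<in> vals (through T t) s"
        by (rule succ_in_vals[OF tree treeD(3)[OF tree s] tt st])
      then show ?thesis by blast
    qed
  next
    fix \<delta> f assume \<delta>: "\<delta> < lam" "is_limit \<delta>" and f: "dom f = {..<\<delta>}" "\<forall>\<beta><\<delta>. f |` {..<\<beta>} \<in> through T t"
    have "f \<in> T" using cl \<delta> f sub unfolding lt_closed_def by (meson subsetD)
    moreover have "f \<subseteq>\<^sub>m t \<or> t \<subseteq>\<^sub>m f"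
    \<comment> \<open>If no proper initial segment of \<open>f\<close> extends \<open>t\<close>,
      then all of them lie below \<open>t\<close>, and so does their union \<open>f\<close>.\<close>
    proof (cases "\<exists>\<beta><\<delta>. t \<subseteq>\<^sub>m f |` {..<\<beta>}")
      case True
      then show ?thesis using restrict_map_le map_le_trans by metis
    next
      case False
      have "f \<gamma> = t \<gamma>" if "\<gamma> \<in> dom f" for \<gamma>
      proof -
        have "\<gamma> < \<delta>" using that f(1) by auto
        then obtain \<beta> where \<beta>: "\<beta> < \<delta>" "\<gamma> < \<beta>" using \<delta>(2) by (auto simp: is_limit_def)
        then have "f |` {..<\<beta>} \<subseteq>\<^sub>m t" using False f(2) by (auto simp: through_def)
        moreover have "\<gamma> \<in> dom (f |` {..<\<beta>})" using \<beta>(2) that by simp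
        ultimately have "(f |` {..<\<beta>}) \<gamma> = t \<gamma>" unfolding map_le_def by (rule bspec)
        then show ?thesis using \<beta>(2) by simp
      qed
      then show ?thesis by (simp add: map_le_def)
    qed
    ultimately show "f \<in> through T t" by (simp add: through_def)
  qed
qed

text \<open>\<open>response\<close> supplies the strategy and \<open>thr\<close> yields
  separativity. A lower bound of a run would contain a node \<open>t\<close> with infinitely many
  successors, and all of these would survive infinitely many shrinkings at \<open>t\<close>.\<close>

lemma tree_forcing_not_distributive:
  assumes ne: "P \<noteq> {}"
    and tree: "\<And>p. p \<in> P \<Longrightarrow> is_tree ks lam p"
    and cl: "\<And>p. p \<in> P \<Longrightarrow> lt_closed lam p"
    and inf: "\<And>p. p \<in> P \<Longrightarrow> \<exists>t\<in>p. infinite (vals p t)"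
    and thr: "\<And>p t. p \<in> P \<Longrightarrow> t \<in> p \<Longrightarrow> through p t \<in> P"
    and response: "\<And>p. p \<in> P \<Longrightarrow>
      \<exists>q\<in>P. q \<subseteq> p \<and> (\<forall>t\<in>q. infinite (vals q t) \<longrightarrow> vals q t \<subseteq> shrink (vals p t))"
  shows "\<not> countably_distributive P (\<subseteq>) \<and> adds_new_omega_sequence P (\<subseteq>)"
proof -
  have "\<forall>p. \<exists>q. p \<in> P \<longrightarrow>
      q \<in> P \<and> q \<subseteq> p \<and> (\<forall>t\<in>q. infinite (vals q t) \<longrightarrow> vals q t \<subseteq> shrink (vals p t))"
    using response by metis
  then obtain r where r: "\<forall>p. p \<in> P \<longrightarrow>
      r p \<in> P \<and> r p \<subseteq> p \<and> (\<forall>t\<in>r p. infinite (vals (r p) t) \<longrightarrow> vals (r p) t \<subseteq> shrink (vals p t))"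
    by (rule choice[THEN exE])
  have vals_mono: "vals p t \<subseteq> vals q t" if "p \<subseteq> q" for p q :: "'o node set" and t
    using that by (auto simp: vals_def)
  show ?thesis
  proof (rule not_distributive_if_strategy[OF ne, of r])
    show "r p \<in> P" "r p \<subseteq> p" if "p \<in> P" for p using r that by simp_all
  next
    fix p :: "nat \<Rightarrow> 'o node set" and q
    assume p: "\<And>n. p n \<in> P" "\<And>n. p (Suc n) \<subseteq> r (p n)" and q: "q \<in> P" "\<And>n. q \<subseteq> p n"
    obtain t where t: "t \<in> q" "infinite (vals q t)" using inf[OF q(1)] by blast
    have "vals (p (Suc n)) t \<subseteq> shrink (vals (p n) t)" for n
    proof -
      \<comment> \<open>Because \<open>q\<close> lies below \<open>r (p n)\<close>, the node
        \<open>t\<close> still has infinitely many successors there, which is the guard in the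
        clause provided by \<open>response\<close>.\<close>
      have qr: "q \<subseteq> r (p n)" using q(2)[of "Suc n"] p(2)[of n] by (rule order_trans)
      have "infinite (vals (r (p n)) t)" using t(2) vals_mono[OF qr] finite_subset by metis
      then have "vals (r (p n)) t \<subseteq> shrink (vals (p n) t)" using r p(1)[of n] qr t(1) by auto
      then show ?thesis using vals_mono[OF p(2)[of n]] by (rule order_trans[rotated])
    qed
    then have "(\<Inter>n. vals (p n) t) = {}" by (rule shrink_sequence_Inter_empty)
    moreover have "vals q t \<subseteq> (\<Inter>n. vals (p n) t)" using vals_mono[OF q(2)] by (rule INT_greatest)
    ultimately show False using t(2) by simp
  next
    fix q a assume q: "q \<in> P" and a: "a \<in> P"
      and comp: "\<And>s. s \<in> P \<Longrightarrow> s \<subseteq> q \<Longrightarrow> compatible P s a"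
    show "q \<subseteq> a"
    proof
      \<comment> \<open>Every condition \<open>c\<close> inside \<open>through q t\<close> contains
        \<open>t\<close>: a branch of \<open>c\<close> of length \<open>lam\<close> has a node of
        the same length as \<open>t\<close>, and that node is comparable with \<open>t\<close>.
        Taking \<open>c\<close> also inside \<open>a\<close> puts \<open>t\<close> into
        \<open>a\<close>.\<close>
      fix t assume t: "t \<in> q"
      have "through q t \<subseteq> q" by (auto simp: through_def)
      then obtain c where c: "c \<in> P" "c \<subseteq> through q t" "c \<subseteq> a"
        using comp[OF thr[OF q t]] by (auto simp: compatible_def)
      have tn: "t \<in> nodes ks lam" using treeD(3)[OF tree[OF q] t] .
      obtain b where b: "dom b = {..<lam}" "Map.empty \<subseteq>\<^sub>m b" "\<And>\<beta>. \<beta> < lam \<Longrightarrow> b |` {..<\<beta>} \<in> c"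
        using branch_exists[OF tree[OF c(1)] cl[OF c(1)] empty_in_tree[OF tree[OF c(1)]]] by metis
      define s where "s = b |` {..<node_len t}"
      have sc: "s \<in> c" unfolding s_def using b(3) nodesD(2)[OF tn] .
      have sn: "s \<in> nodes ks lam" using treeD(3)[OF tree[OF c(1)] sc] .
      have "node_len s = node_len t"
        unfolding s_def using dom_restrict_branch(2)[OF b(1)] nodesD(2)[OF tn] by simp
      moreover have "s \<subseteq>\<^sub>m t \<or> t \<subseteq>\<^sub>m s" using sc c(2) by (auto simp: through_def)
      ultimately have "s = t" using map_le_len_eq[OF sn tn] map_le_len_eq[OF tn sn] by metis
      then show "t \<in> a" using sc c(3) by auto
    qed
  qed
qed

lemma full_tree:
  shows "is_tree ks lam (nodes ks lam)" "lt_closed lam (nodes ks lam)"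
    "\<And>t. t \<in> nodes ks lam \<Longrightarrow> vals (nodes ks lam) t = {..<ks (node_len t)}"
proof -
  show tree: "is_tree ks lam (nodes ks lam)" using empty_node unfolding is_tree_def by auto
  show v: "vals (nodes ks lam) t = {..<ks (node_len t)}" if t: "t \<in> nodes ks lam" for t
  proof (rule set_eqI)
    fix \<xi>
    let ?s = "t(node_len t \<mapsto> \<xi>)"
    have "?s \<in> nodes ks lam \<longleftrightarrow> \<xi> < ks (node_len t)"
    proof
      assume "?s \<in> nodes ks lam"
      from nodesD(3)[OF this, of "node_len t" \<xi>] show "\<xi> < ks (node_len t)" by simp
    next
      assume "\<xi> < ks (node_len t)"
      then show "?s \<in> nodes ks lam"
        using dom_extend(1)[OF t, of \<xi>] osuc_less_lam[OF nodesD(2)[OF t]] nodesD(3)[OF t]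
        unfolding nodes_def by (auto intro!: exI[of _ "osuc (node_len t)"] split: if_splits)
    qed
    then show "\<xi> \<in> vals (nodes ks lam) t \<longleftrightarrow> \<xi> \<in> {..<ks (node_len t)}" by (simp add: vals_def)
  qed
  show "lt_closed lam (nodes ks lam)"
    unfolding lt_closed_iff[OF tree]
  proof (intro conjI ballI allI impI; (elim conjE)?)
    fix t assume "t \<in> nodes ks lam"
    then show "vals (nodes ks lam) t \<noteq> {}" using v infinite_ks[of "node_len t"] nodesD(2)[of t] by auto
  next
    fix \<delta> f assume \<delta>: "\<delta> < lam" "is_limit \<delta>"
      and f: "dom f = {..<\<delta>}" "\<forall>\<beta><\<delta>. f |` {..<\<beta>} \<in> nodes ks lam"
    have "\<xi> < ks \<beta>" if \<xi>: "f \<beta> = Some \<xi>" for \<beta> \<xi>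
    proof -
      have "\<beta> < \<delta>" using f(1) \<xi> by auto
      then obtain \<gamma> where \<gamma>: "\<gamma> < \<delta>" "\<beta> < \<gamma>" using \<delta>(2) by (auto simp: is_limit_def)
      then show ?thesis using nodesD(3)[of "f |` {..<\<gamma>}" \<beta> \<xi>] f(2) \<xi> by simp
    qed
    then show "f \<in> nodes ks lam" using \<delta>(1) f(1) unfolding nodes_def by auto
  qed
qed

end

section \<open>Laver forcing\<close>

context cardinal_sequence
begin

lemma LaverD:
  assumes "p \<in> Laver ks lam"
  obtains s where "is_tree ks lam p" "lt_closed lam p" "s \<in> p"
    "\<And>t. t \<in> p \<Longrightarrow> s \<subseteq>\<^sub>m t \<or> t \<subseteq>\<^sub>m s"
    "\<And>t. t \<in> p \<Longrightarrow> s \<subseteq>\<^sub>m t \<Longrightarrow> vals p t \<approx> {..<ks (node_len t)}"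
proof -
  have tree: "is_tree ks lam p" using assms by (simp add: Laver_def)
  obtain s where s: "s \<in> p" "\<forall>t\<in>p. s \<subseteq>\<^sub>m t \<or> t \<subseteq>\<^sub>m s"
    "\<forall>t\<in>p. s \<subseteq>\<^sub>m t \<longrightarrow> Succs p t \<approx> {..<ks (node_len t)}"
    using assms unfolding Laver_def by auto
  show thesis
  proof (rule that[of s])
    show "vals p t \<approx> {..<ks (node_len t)}" if "t \<in> p" "s \<subseteq>\<^sub>m t" for t
      using s(3) that Succs_eqpoll[OF tree that(1)] eqpoll_sym eqpoll_trans by metis
  qed (use s tree assms in \<open>auto simp: Laver_def\<close>)
qed

lemma LaverI:
  assumes tree: "is_tree ks lam p" and "lt_closed lam p" "s \<in> p"
    "\<And>t. t \<in> p \<Longrightarrow> s \<subseteq>\<^sub>m t \<or> t \<subseteq>\<^sub>m s"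
    and v: "\<And>t. t \<in> p \<Longrightarrow> s \<subseteq>\<^sub>m t \<Longrightarrow> vals p t \<approx> {..<ks (node_len t)}"
  shows "p \<in> Laver ks lam"
proof -
  have "Succs p t \<approx> {..<ks (node_len t)}" if "t \<in> p" "s \<subseteq>\<^sub>m t" for t
    using Succs_eqpoll[OF tree that(1)] v[OF that] by (rule eqpoll_trans)
  with assms show ?thesis unfolding Laver_def by auto
qed

lemma infinite_vals_Laver:
  assumes p: "is_tree ks lam p" "t \<in> p" "vals p t \<approx> {..<ks (node_len t)}"
  shows "infinite (vals p t)"
  using infinite_ks[OF nodesD(2)[OF treeD(3)[OF p(1,2)]]] eqpoll_finite_iff[OF p(3)] by simp

lemma full_tree_Laver: "nodes ks lam \<in> Laver ks lam"
  by (rule LaverI[of _ Map.empty]) (use full_tree empty_in_tree[OF full_tree(1)] in auto)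

text \<open>The longer of \<open>s\<close> and \<open>t\<close> is a stem of the restricted tree,
  and above it \<open>through p t\<close> has the same successors as \<open>p\<close>.\<close>

lemma through_Laver:
  assumes "p \<in> Laver ks lam" and t: "t \<in> p"
  shows "through p t \<in> Laver ks lam"
proof -
  obtain s where p: "is_tree ks lam p" "lt_closed lam p" and s: "s \<in> p"
    "\<And>t. t \<in> p \<Longrightarrow> s \<subseteq>\<^sub>m t \<or> t \<subseteq>\<^sub>m s"
    "\<And>t. t \<in> p \<Longrightarrow> s \<subseteq>\<^sub>m t \<Longrightarrow> vals p t \<approx> {..<ks (node_len t)}"
    using LaverD[OF assms(1)] by metis
  note th = through_tree[OF p t]
  have sub: "u \<in> p" if "u \<in> through p t" for u using that by (simp add: through_def)
  show ?thesis
  proof (cases "s \<subseteq>\<^sub>m t")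
    case True
    show ?thesis
    proof (rule LaverI[OF th(1,2,3)])
      show "t \<subseteq>\<^sub>m u \<or> u \<subseteq>\<^sub>m t" if "u \<in> through p t" for u using that by (auto simp: through_def)
      show "vals (through p t) u \<approx> {..<ks (node_len u)}" if "u \<in> through p t" "t \<subseteq>\<^sub>m u" for u
        using th(4)[OF sub[OF that(1)] that(2)] s(3)[OF sub[OF that(1)] map_le_trans[OF True that(2)]] by simp
    qed
  next
    case False
    then have ts: "t \<subseteq>\<^sub>m s" using s(2)[OF t] by simp
    show ?thesis
    proof (rule LaverI[OF th(1,2)])
      show "s \<in> through p t" using s(1) ts by (simp add: through_def)
      show "s \<subseteq>\<^sub>m u \<or> u \<subseteq>\<^sub>m s" if "u \<in> through p t" for u using s(2)[OF sub[OF that]] .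
      show "vals (through p t) u \<approx> {..<ks (node_len u)}" if "u \<in> through p t" "s \<subseteq>\<^sub>m u" for u
        using th(4)[OF sub[OF that(1)] map_le_trans[OF ts that(2)]] s(3)[OF sub[OF that(1)] that(2)] by simp
    qed
  qed
qed

text \<open>Shrinking an infinite successor set keeps its cardinality, so the requirement above the
  stem persists. Strictly below the stem the successor sets are finite and stay untouched, which
  prevents the stem from being pruned away.\<close>

lemma response_Laver:
  assumes "p \<in> Laver ks lam"
  shows "\<exists>q\<in>Laver ks lam. q \<subseteq> p \<and> (\<forall>t\<in>q. infinite (vals q t) \<longrightarrow> vals q t \<subseteq> shrink (vals p t))"
proof -
  obtain s where p: "is_tree ks lam p" "lt_closed lam p" and s: "s \<in> p"
    "\<And>t. t \<in> p \<Longrightarrow> s \<subseteq>\<^sub>m t \<or> t \<subseteq>\<^sub>m s"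
    "\<And>t. t \<in> p \<Longrightarrow> s \<subseteq>\<^sub>m t \<Longrightarrow> vals p t \<approx> {..<ks (node_len t)}"
    using LaverD[OF assms(1)] by metis
  define R where "R t = (if infinite (vals p t) then shrink (vals p t) else vals p t)" for t
  have R: "R t \<subseteq> vals p t" for t using shrink_subset by (auto simp: R_def)
  have Rv: "R t \<approx> vals p t" for t using shrink_eqpoll by (auto simp: R_def)
  have "R t \<noteq> {}" if "t \<in> p" for t
  proof
    assume "R t = {}"
    then have "vals p t = {}" using Rv[of t] eqpoll_empty_iff_empty eqpoll_sym by metis
    then show False using p(2) that unfolding lt_closed_iff[OF p(1)] by blast
  qed
  with R have "\<forall>t\<in>p. R t \<subseteq> vals p t \<and> R t \<noteq> {}" by simp
  note q = prune_tree[OF p this]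
  have sub: "prune p R \<subseteq> p" by (auto simp: prune_def)
  have sn: "s \<in> nodes ks lam" using treeD(3)[OF p(1) s(1)] .
  have "\<xi> \<in> R (s |` {..<\<beta>})" if \<xi>: "s \<beta> = Some \<xi>" for \<beta> \<xi>
  proof -
    let ?u = "s |` {..<\<beta>}"
    have \<beta>: "\<beta> < node_len s" using less_len[OF sn \<xi>] .
    have len: "node_len ?u = \<beta>" using dom_restrict_branch(2)[OF nodesD(1)[OF sn]] \<beta> by simp
    have u: "?u \<in> p" using treeD(5)[OF p(1) s(1)] .
    \<comment> \<open>The stem is comparable with every node, so the finiteness below
      \<open>s\<close> in \<open>through p s\<close> is finiteness in \<open>p\<close>
      itself.\<close>
    have eq: "through p s = p" using s(2) by (auto simp: through_def)
    have "\<not> s \<subseteq>\<^sub>m ?u" using map_le_len(1)[OF sn treeD(3)[OF p(1) u]] len \<beta> by auto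
    then have "finite (vals p ?u)" using through_tree(5)[OF p s(1), of ?u] u unfolding eq by simp
    moreover have "?u(\<beta> \<mapsto> \<xi>) \<in> p"
      using restrict_osuc[OF nodesD(1)[OF sn] \<beta> \<xi>] treeD(5)[OF p(1) s(1), of "osuc \<beta>"] by simp
    ultimately show ?thesis by (simp add: R_def vals_def len)
  qed
  then have "s \<in> prune p R" using s(1) by (simp add: prune_def)
  have "prune p R \<in> Laver ks lam"
  proof (rule LaverI[OF q(1,2) \<open>s \<in> prune p R\<close>])
    show "s \<subseteq>\<^sub>m t \<or> t \<subseteq>\<^sub>m s" if "t \<in> prune p R" for t using that sub s(2) by auto
    show "vals (prune p R) t \<approx> {..<ks (node_len t)}" if "t \<in> prune p R" "s \<subseteq>\<^sub>m t" for t
    proof -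
      have "t \<in> p" using that(1) sub by auto
      then show ?thesis using q(3)[OF that(1)] eqpoll_trans[OF Rv s(3)[OF _ that(2)]] by simp
    qed
  qed
  moreover have "vals (prune p R) t \<subseteq> shrink (vals p t)"
    if "t \<in> prune p R" "infinite (vals (prune p R) t)" for t
  proof -
    have "R t = shrink (vals p t)" using that(2) q(3)[OF that(1)] by (auto simp: R_def split: if_splits)
    then show ?thesis using q(3)[OF that(1)] by simp
  qed
  ultimately show ?thesis using sub by (intro bexI[of _ "prune p R"]) auto
qed

lemma Laver_not_distributive:
  "\<not> countably_distributive (Laver ks lam) (\<subseteq>) \<and> adds_new_omega_sequence (Laver ks lam) (\<subseteq>)"
proof (rule tree_forcing_not_distributive)
  show "Laver ks lam \<noteq> {}" using full_tree_Laver by blast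
  show "\<exists>t\<in>p. infinite (vals p t)" if "p \<in> Laver ks lam" for p
    using LaverD[OF that] infinite_vals_Laver map_le_refl by metis
qed (use through_Laver response_Laver in \<open>auto simp: Laver_def\<close>)

end

section \<open>Miller forcing\<close>

text \<open>\<open>cnt ks p b \<beta>\<close> is the order type of the set of those \<open>\<gamma> < \<beta>\<close> for which \<open>b \<restriction> \<gamma>\<close> is counted, where
  a node of \<open>p\<close> is counted if its splitting matches its own count.\<close>

function cnt :: "('o::wellorder \<Rightarrow> 'o) \<Rightarrow> 'o node set \<Rightarrow> 'o node \<Rightarrow> 'o \<Rightarrow> 'o" where
  "cnt ks p b \<beta> = (LEAST \<alpha>. \<forall>\<gamma>. \<gamma> < \<beta> \<longrightarrow>
     splitting (ks (cnt ks p b \<gamma>)) p (b |` {..<\<gamma>}) \<longrightarrow> cnt ks p b \<gamma> < \<alpha>)"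
  by pat_completeness auto
termination
  by (relation "inv_image {(x, y). x < y} (\<lambda>(_, _, _, \<beta>). \<beta>)")
    (auto intro: wf_inv_image wf)

declare cnt.simps [simp del]

definition counted :: "('o::wellorder \<Rightarrow> 'o) \<Rightarrow> 'o node set \<Rightarrow> 'o node \<Rightarrow> 'o \<Rightarrow> bool" where
  "counted ks p b \<beta> \<longleftrightarrow> splitting (ks (cnt ks p b \<beta>)) p (b |` {..<\<beta>})"

lemma cnt_eq_Least:
  "cnt ks p b \<beta> = (LEAST \<alpha>. \<forall>\<gamma><\<beta>. counted ks p b \<gamma> \<longrightarrow> cnt ks p b \<gamma> < \<alpha>)"
  unfolding counted_def by (rule cnt.simps)

lemma cnt_le: "cnt ks p b \<beta> \<le> \<beta>"
proof (induction \<beta> rule: less_induct)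
  case (less \<beta>)
  then show ?case unfolding cnt_eq_Least[of ks p b \<beta>] by (intro Least_le) (meson order_le_less_trans)
qed

lemma cnt_less:
  assumes "\<gamma> < \<beta>" "counted ks p b \<gamma>"
  shows "cnt ks p b \<gamma> < cnt ks p b \<beta>"
proof -
  \<comment> \<open>The \<open>LEAST\<close> is informative only if a strict bound exists; by
    \<open>cnt_le\<close>, \<open>\<beta>\<close> is one, even in a type with a largest
    element.\<close>
  have "\<forall>\<gamma><\<beta>. counted ks p b \<gamma> \<longrightarrow> cnt ks p b \<gamma> < \<beta>" using cnt_le by (meson order_le_less_trans)
  then have "\<forall>\<gamma><\<beta>. counted ks p b \<gamma> \<longrightarrow> cnt ks p b \<gamma> < cnt ks p b \<beta>"
    unfolding cnt_eq_Least[of ks p b \<beta>] by (rule LeastI)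
  with assms show ?thesis by blast
qed

text \<open>No count is skipped, which together with \<open>cnt_less\<close> justifies reading
  \<open>cnt\<close> as an order type. A value below the least strict bound is at most the count of
  some counted \<open>\<gamma> < \<beta>\<close>; if it is smaller, the argument repeats below
  \<open>\<gamma>\<close>.\<close>

lemma cnt_attained:
  "\<xi> < cnt ks p b \<beta> \<Longrightarrow> \<exists>\<gamma><\<beta>. counted ks p b \<gamma> \<and> cnt ks p b \<gamma> = \<xi>"
proof (induction \<beta> rule: less_induct)
  case (less \<beta>)
  from not_less_Least[OF less.prems[unfolded cnt_eq_Least[of ks p b \<beta>]]]
  obtain \<gamma> where \<gamma>: "\<gamma> < \<beta>" "counted ks p b \<gamma>" "\<xi> \<le> cnt ks p b \<gamma>" by (meson leI)
  show ?case
  proof (cases "\<xi> = cnt ks p b \<gamma>")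
    case False
    then show ?thesis using less.IH[OF \<gamma>(1)] \<gamma> by (meson order_le_neq_trans order_less_trans)
  qed (use \<gamma> in auto)
qed

text \<open>The recursion consults only initial segments of \<open>b\<close> below
  \<open>\<beta>\<close>. So the count belongs to the node, and
  \<open>cnt ks p t (node_len t)\<close> agrees with the count along any branch through
  \<open>t\<close>.\<close>

lemma cnt_cong:
  "b |` {..<\<beta>} = b' |` {..<\<beta>} \<Longrightarrow> cnt ks p b \<beta> = cnt ks p b' \<beta>"
proof (induction \<beta> rule: less_induct)
  case (less \<beta>)
  have "counted ks p b \<gamma> \<longleftrightarrow> counted ks p b' \<gamma>" and "cnt ks p b \<gamma> = cnt ks p b' \<gamma>"
    if \<gamma>: "\<gamma> < \<beta>" for \<gamma>
  proof -
    have "{..<\<beta>} \<inter> {..<\<gamma>} = {..<\<gamma>}" using \<gamma> by auto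
    then have eq: "b |` {..<\<gamma>} = b' |` {..<\<gamma>}"
      using arg_cong[OF less.prems, of "\<lambda>x. x |` {..<\<gamma>}"] by simp
    then show "cnt ks p b \<gamma> = cnt ks p b' \<gamma>" by (rule less.IH[OF \<gamma>])
    then show "counted ks p b \<gamma> \<longleftrightarrow> counted ks p b' \<gamma>" unfolding counted_def eq by simp
  qed
  then show ?case unfolding cnt_eq_Least[of _ _ _ \<beta>] by simp
qed

lemma cnt_inj:
  "counted ks p b \<gamma> \<Longrightarrow> counted ks p b \<gamma>' \<Longrightarrow> cnt ks p b \<gamma> = cnt ks p b \<gamma>' \<Longrightarrow> \<gamma> = \<gamma>'"
  by (metis cnt_less less_irrefl linorder_neqE)

lemma cnt_const:
  assumes "\<gamma> \<le> \<beta>" "\<And>\<zeta>. \<gamma> \<le> \<zeta> \<Longrightarrow> \<zeta> < \<beta> \<Longrightarrow> \<not> counted ks p b \<zeta>"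
  shows "cnt ks p b \<beta> = cnt ks p b \<gamma>"
proof -
  have "\<zeta> < \<gamma>" if "\<zeta> < \<beta>" "counted ks p b \<zeta>" for \<zeta> using assms(2) that by (meson leI)
  then have "(\<forall>\<zeta><\<beta>. counted ks p b \<zeta> \<longrightarrow> cnt ks p b \<zeta> < \<alpha>) \<longleftrightarrow>
    (\<forall>\<zeta><\<gamma>. counted ks p b \<zeta> \<longrightarrow> cnt ks p b \<zeta> < \<alpha>)" for \<alpha>
    using assms(1) by (meson order_less_le_trans)
  then show ?thesis unfolding cnt_eq_Least[of ks p b \<beta>] cnt_eq_Least[of ks p b \<gamma>] by simp
qed

text \<open>Choosing the least target in a fixed well-order of all nodes makes the choice constant along
  the path to the target.\<close>

lemma coherent_choice:
  fixes Q :: "'w \<Rightarrow> ('a \<rightharpoonup> 'b) \<Rightarrow> bool"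
  shows "\<exists>\<tau>. \<forall>w t. (\<exists>u. Q w u \<and> t \<subseteq>\<^sub>m u) \<longrightarrow>
    Q w (\<tau> w t) \<and> t \<subseteq>\<^sub>m \<tau> w t \<and> (\<forall>u. t \<subseteq>\<^sub>m u \<and> u \<subseteq>\<^sub>m \<tau> w t \<longrightarrow> \<tau> w u = \<tau> w t)"
proof -
  obtain r :: "('a \<rightharpoonup> 'b) rel" where r: "well_order_on UNIV r" using well_order_on by blast
  have wf: "wf (r - Id)" using r by (simp add: well_order_on_def)
  have tot: "(x, y) \<in> r - Id" if "(y, x) \<notin> r - Id" "x \<noteq> y" for x y
    using r that by (auto simp: well_order_on_def linear_order_on_def total_on_def)
  define least where "least X x \<longleftrightarrow> x \<in> X \<and> (\<forall>y. (y, x) \<in> r - Id \<longrightarrow> y \<notin> X)" for X x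
  have ex: "\<exists>x. least X x" if "x \<in> X" for x X
    using wfE_min[OF wf that] unfolding least_def by metis
  have uniq: "x = y" if "least X x" "least X y" for x y X
    using tot[of x y] that unfolding least_def by metis
  define \<tau> where "\<tau> w t = (SOME x. least {u. Q w u \<and> t \<subseteq>\<^sub>m u} x)" for w t
  have \<tau>: "least {u. Q w u \<and> t \<subseteq>\<^sub>m u} (\<tau> w t)" if "Q w u" "t \<subseteq>\<^sub>m u" for w t u
    unfolding \<tau>_def using that by (intro someI_ex[OF ex[of u]]) simp
  show ?thesis
  proof (intro exI[of _ \<tau>] allI impI)
    fix w t assume "\<exists>u. Q w u \<and> t \<subseteq>\<^sub>m u"
    then have l: "least {u. Q w u \<and> t \<subseteq>\<^sub>m u} (\<tau> w t)" using \<tau> by metis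
    then have m: "Q w (\<tau> w t)" "t \<subseteq>\<^sub>m \<tau> w t" by (auto simp: least_def)
    \<comment> \<open>The candidates above \<open>u\<close> are among those above \<open>t\<close>
      and still include \<open>\<tau> w t\<close>, so the least candidate does not change.\<close>
    have coh: "\<tau> w u = \<tau> w t" if u: "t \<subseteq>\<^sub>m u" "u \<subseteq>\<^sub>m \<tau> w t" for u
    proof (rule uniq)
      show "least {v. Q w v \<and> u \<subseteq>\<^sub>m v} (\<tau> w u)" using \<tau>[OF m(1) u(2)] .
      show "least {v. Q w v \<and> u \<subseteq>\<^sub>m v} (\<tau> w t)"
        using l m u map_le_trans[OF u(1)] unfolding least_def mem_Collect_eq by metis
    qed
    show "Q w (\<tau> w t) \<and> t \<subseteq>\<^sub>m \<tau> w t \<and> (\<forall>u. t \<subseteq>\<^sub>m u \<and> u \<subseteq>\<^sub>m \<tau> w t \<longrightarrow> \<tau> w u = \<tau> w t)"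
      by (intro conjI allI impI m coh) (elim conjE, assumption)+
  qed
qed

section \<open>Thinning a Miller tree along its counted nodes\<close>

context cardinal_sequence
begin

lemma counted_restrict:
  "counted ks p (b |` {..<\<beta>}) \<beta> \<longleftrightarrow> counted ks p b \<beta>"
  "cnt ks p (b |` {..<\<beta>}) \<beta> = cnt ks p b \<beta>"
  using cnt_cong[of "b |` {..<\<beta>}" \<beta> b ks p] by (simp_all add: counted_def)

lemma splitting_infinite:
  assumes "is_tree ks lam p" "splitting (ks \<alpha>) p t" "\<alpha> < lam"
  shows "infinite (vals p t)"
  using assms(2) infinite_ks[OF assms(3)] unfolding splitting_iff[OF assms(1)] lepoll_def
  by (metis finite_imageD finite_subset)

lemma splitting_mono:
  assumes "splitting (ks \<beta>) p t" "\<alpha> \<le> \<beta>" "\<beta> < lam"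
  shows "splitting (ks \<alpha>) p t"
  using assms ks_lepoll_iff[of \<alpha> \<beta>] unfolding splitting_def by (meson lepoll_trans order_le_less_trans)

text \<open>On a branch of the thinned tree without further counted nodes, the count and hence the
  target would be constant; the branch would reach the target, which would then be counted. So
  counted nodes recur along every branch, and since distinct ones have distinct counts, regularity
  makes the counts unbounded.\<close>

lemma thinning:
  assumes p: "is_tree ks lam p" "lt_closed lam p" and ev: "ever_branching ks lam p"
  obtains q where "is_tree ks lam q" "lt_closed lam q" "ever_branching ks lam q" "q \<subseteq> p"
    "\<And>t. t \<in> q \<Longrightarrow> infinite (vals q t) \<Longrightarrow> counted ks p t (node_len t)"
    "\<And>t. t \<in> q \<Longrightarrow> counted ks p t (node_len t) \<Longrightarrow> vals q t = shrink (vals p t)"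
proof -
  obtain \<tau> where \<tau>: "\<And>w t u. splitting (ks w) p u \<Longrightarrow> t \<subseteq>\<^sub>m u \<Longrightarrow>
      splitting (ks w) p (\<tau> w t) \<and> t \<subseteq>\<^sub>m \<tau> w t \<and>
      (\<forall>u. t \<subseteq>\<^sub>m u \<and> u \<subseteq>\<^sub>m \<tau> w t \<longrightarrow> \<tau> w u = \<tau> w t)"
    using coherent_choice[of "\<lambda>w. splitting (ks w) p"] by metis
  define w where "w t = cnt ks p t (node_len t)" for t
  have w_lam: "w t < lam" if "t \<in> p" for t
    using cnt_le[of ks p t "node_len t"] nodesD(2)[OF treeD(3)[OF p(1) that]] by (simp add: w_def)
  have target: "splitting (ks \<alpha>) p (\<tau> \<alpha> t)" "t \<subseteq>\<^sub>m \<tau> \<alpha> t"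
    "\<And>u. t \<subseteq>\<^sub>m u \<Longrightarrow> u \<subseteq>\<^sub>m \<tau> \<alpha> t \<Longrightarrow> \<tau> \<alpha> u = \<tau> \<alpha> t" if "t \<in> p" "\<alpha> < lam" for t \<alpha>
  proof -
    obtain u where "splitting (ks \<alpha>) p u" "t \<subseteq>\<^sub>m u" using ev \<open>t \<in> p\<close> \<open>\<alpha> < lam\<close> unfolding ever_branching_def by metis
    note * = \<tau>[OF this]
    show "splitting (ks \<alpha>) p (\<tau> \<alpha> t)" using * by (rule conjunct1)
    show "t \<subseteq>\<^sub>m \<tau> \<alpha> t" using * by (elim conjE)
    show "\<tau> \<alpha> u = \<tau> \<alpha> t" if "t \<subseteq>\<^sub>m u" "u \<subseteq>\<^sub>m \<tau> \<alpha> t" for u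
      using *[THEN conjunct2, THEN conjunct2, rule_format, OF conjI[OF that]] .
  qed
  have counted_len: "counted ks p t (node_len t) \<longleftrightarrow> splitting (ks (w t)) p t" if "t \<in> p" for t
    using restrict_len[OF treeD(3)[OF p(1) that]] by (simp add: counted_def w_def)
  have counted_inf: "infinite (vals p t)" if "t \<in> p" "counted ks p t (node_len t)" for t
    using that splitting_infinite[OF p(1) _ w_lam] counted_len by simp
  \<comment> \<open>An uncounted \<open>t\<close> is not its own target, since the target is
    \<open>ks (w t)\<close>-splitting and \<open>t\<close> is not. Hence the target is defined at
    \<open>node_len t\<close>, and \<open>the\<close> reads off a genuine value.\<close>
  define R where "R t = (if counted ks p t (node_len t) then shrink (vals p t)
    else {the (\<tau> (w t) t (node_len t))})" for t
  have R: "\<forall>t\<in>p. R t \<subseteq> vals p t \<and> R t \<noteq> {}"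
  proof
    fix t assume t: "t \<in> p"
    show "R t \<subseteq> vals p t \<and> R t \<noteq> {}"
    proof (cases "counted ks p t (node_len t)")
      case True
      then have inf: "infinite (vals p t)" using counted_inf[OF t] by simp
      then have "shrink (vals p t) \<noteq> {}"
        using eqpoll_finite_iff[OF shrink_eqpoll[OF inf]] by auto
      then show ?thesis using True shrink_subset by (simp add: R_def)
    next
      case False
      let ?u = "\<tau> (w t) t"
      note tg = target[OF t w_lam[OF t]]
      have "t \<noteq> ?u" using False tg(1) counted_len[OF t] by auto
      moreover have "?u \<in> p" using tg(1) by (simp add: splitting_def)
      ultimately obtain \<xi> where "?u (node_len t) = Some \<xi>" "\<xi> \<in> vals p t"
        using succ_in_vals[OF p(1) treeD(3)[OF p(1) t] _ tg(2)] by metis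
      then show ?thesis using False by (simp add: R_def)
    qed
  qed
  define q where "q = prune p R"
  note q = prune_tree[OF p R, folded q_def]
  have sub: "q \<subseteq> p" by (auto simp: prune_def q_def)
  have q_counted: "counted ks p t (node_len t)" if "t \<in> q" "infinite (vals q t)" for t
    using that q(3)[OF that(1)] by (auto simp: R_def split: if_splits)
  have q_shrink: "vals q t = shrink (vals p t)" if "t \<in> q" "counted ks p t (node_len t)" for t
    using q(3)[OF that(1)] that(2) by (simp add: R_def)
  have "ever_branching ks lam q"
    unfolding ever_branching_def
  proof (intro ballI allI impI)
    fix s \<alpha> assume s: "s \<in> q" and \<alpha>: "\<alpha> < lam"
    obtain b where b: "dom b = {..<lam}" "s \<subseteq>\<^sub>m b" "\<And>\<beta>. \<beta> < lam \<Longrightarrow> b |` {..<\<beta>} \<in> q"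
      using branch_exists[OF q(1,2) s] by metis
    have len: "node_len (b |` {..<\<gamma>}) = \<gamma>" "dom (b |` {..<\<gamma>}) = {..<\<gamma>}" if "\<gamma> < lam" for \<gamma>
      using dom_restrict_branch[OF b(1)] that by simp_all
    have bp: "b |` {..<\<gamma>} \<in> p" if "\<gamma> < lam" for \<gamma> using b(3)[OF that] sub by auto
    have unbounded: "\<exists>\<gamma>\<ge>\<beta>. \<gamma> < lam \<and> counted ks p b \<gamma>" if \<beta>: "\<beta> < lam" for \<beta>
    proof (rule ccontr)
      assume "\<not> ?thesis"
      then have no: "\<not> counted ks p b \<gamma>" if "\<beta> \<le> \<gamma>" "\<gamma> < lam" for \<gamma> using that by metis
      define v where "v = cnt ks p b \<beta>"
      have v: "cnt ks p b \<gamma> = v" if "\<beta> \<le> \<gamma>" "\<gamma> < lam" for \<gamma>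
        unfolding v_def using that no by (intro cnt_const) auto
      have v_lam: "v < lam" unfolding v_def using cnt_le \<beta> by (rule order_le_less_trans)
      define u where "u = \<tau> v (b |` {..<\<beta>})"
      note tg = target[OF bp[OF \<beta>] v_lam, folded u_def]
      have up: "u \<in> p" using tg(1) by (simp add: splitting_def)
      have un: "u \<in> nodes ks lam" using treeD(3)[OF p(1) up] .
      have u_lam: "node_len u < lam" using nodesD(2)[OF un] .
      \<comment> \<open>Below \<open>\<beta>\<close> the target \<open>u\<close> extends the branch
        by choice. From \<open>\<beta>\<close> on, agreement so far makes \<open>u\<close> the
        target of the current node by coherence, and \<open>R\<close> leaves only the value that
        \<open>u\<close> takes next.\<close>
      have bu: "b \<zeta> = u \<zeta>" if "\<zeta> < node_len u" for \<zeta>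
        using that
      proof (induction \<zeta> rule: less_induct)
        case (less \<zeta>)
        have \<zeta>: "\<zeta> < lam" using less.prems u_lam by simp
        show ?case
        proof (cases "\<zeta> < \<beta>")
          case True
          then have "\<zeta> \<in> dom (b |` {..<\<beta>})" using len(2)[OF \<beta>] by simp
          then have "(b |` {..<\<beta>}) \<zeta> = u \<zeta>" using tg(2) unfolding map_le_def by (rule bspec[rotated])
          then show ?thesis using True by simp
        next
          case False
          then have "\<beta> \<le> \<zeta>" by simp
          have "b |` {..<\<zeta>} \<subseteq>\<^sub>m u"
            unfolding map_le_def len(2)[OF \<zeta>] using less by auto
          moreover have "b |` {..<\<beta>} \<subseteq>\<^sub>m b |` {..<\<zeta>}" using \<open>\<beta> \<le> \<zeta>\<close> by (intro restrict_mono_le) auto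
          ultimately have \<tau>u: "\<tau> v (b |` {..<\<zeta>}) = u" using tg(3) by simp
          have "R (b |` {..<\<zeta>}) = {the (u \<zeta>)}"
            using no[OF \<open>\<beta> \<le> \<zeta>\<close> \<zeta>] v[OF \<open>\<beta> \<le> \<zeta>\<close> \<zeta>] \<tau>u
            by (simp add: R_def w_def len(1)[OF \<zeta>] counted_restrict)
          moreover obtain \<xi> where \<xi>: "b \<zeta> = Some \<xi>" using b(1) \<zeta> by (auto simp: dom_def set_eq_iff)
          have "\<xi> \<in> vals q (b |` {..<\<zeta>})"
            using b(3)[OF osuc_less_lam[OF \<zeta>]] restrict_osuc[OF b(1) \<zeta> \<xi>] by (simp add: vals_def len(1)[OF \<zeta>])
          then have "\<xi> \<in> R (b |` {..<\<zeta>})" using q(3)[OF b(3)[OF \<zeta>]] by simp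
          moreover obtain \<eta> where "u \<zeta> = Some \<eta>"
            using less.prems nodesD(1)[OF un] by (auto simp: dom_def set_eq_iff)
          ultimately show ?thesis using \<xi> by simp
        qed
      qed
      have bu': "b |` {..<node_len u} = u"
      proof -
        have "b |` {..<node_len u} = u |` {..<node_len u}"
          using bu by (auto simp: restrict_map_def fun_eq_iff)
        then show ?thesis using restrict_len[OF un] by simp
      qed
      have "\<beta> \<le> node_len u" using map_le_len(1)[OF treeD(3)[OF p(1) bp[OF \<beta>]] un tg(2)] len(1)[OF \<beta>] by simp
      \<comment> \<open>At the length of \<open>u\<close> the count is still \<open>v\<close>, and
        \<open>u\<close> was chosen to be \<open>ks v\<close>-splitting.\<close>
      then have "counted ks p b (node_len u)"
        unfolding counted_def bu' using v u_lam tg(1) by simp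
      then show False using no \<open>\<beta> \<le> node_len u\<close> u_lam by simp
    qed
    have "\<exists>\<gamma>\<ge>node_len s. \<gamma> < lam \<and> counted ks p b \<gamma> \<and> \<alpha> \<le> cnt ks p b \<gamma>"
    proof (rule ccontr)
      assume "\<not> ?thesis"
      then have small: "cnt ks p b \<gamma> < \<alpha>" if "node_len s \<le> \<gamma>" "\<gamma> < lam" "counted ks p b \<gamma>" for \<gamma>
        using that by (meson leI)
      define f where "f \<xi> = (if \<exists>\<gamma><lam. counted ks p b \<gamma> \<and> cnt ks p b \<gamma> = \<xi>
        then SOME \<gamma>. \<gamma> < lam \<and> counted ks p b \<gamma> \<and> cnt ks p b \<gamma> = \<xi> else \<alpha>)" for \<xi>
      have f: "f \<xi> < lam \<and> counted ks p b (f \<xi>) \<and> cnt ks p b (f \<xi>) = \<xi>"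
        if ex: "\<exists>\<gamma><lam. counted ks p b \<gamma> \<and> cnt ks p b \<gamma> = \<xi>" for \<xi>
        using someI_ex[OF ex] ex by (simp add: f_def)
      have "f \<xi> < lam" for \<xi> using f[of \<xi>] \<alpha> by (cases "\<exists>\<gamma><lam. counted ks p b \<gamma> \<and> cnt ks p b \<gamma> = \<xi>") (auto simp: f_def)
      then obtain \<beta> where \<beta>: "\<beta> < lam" "\<forall>i<\<alpha>. f i < \<beta>" using lam_regular[OF \<alpha>, of f] by metis
      have s_lam: "node_len s < lam" using nodesD(2)[OF treeD(3)[OF q(1) s]] .
      have "max \<beta> (node_len s) < lam" using \<beta>(1) s_lam by simp
      then obtain \<gamma> where \<gamma>: "max \<beta> (node_len s) \<le> \<gamma>" "\<gamma> < lam" "counted ks p b \<gamma>"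
        using unbounded by metis
      then have "cnt ks p b \<gamma> < \<alpha>" using small by simp
      then have "f (cnt ks p b \<gamma>) < \<beta>" using \<beta>(2) by simp
      moreover have "f (cnt ks p b \<gamma>) = \<gamma>" using f[of "cnt ks p b \<gamma>"] \<gamma>(2,3) cnt_inj by metis
      ultimately show False using \<gamma>(1) by auto
    qed
    then obtain \<gamma> where \<gamma>: "node_len s \<le> \<gamma>" "\<gamma> < lam" "counted ks p b \<gamma>" "\<alpha> \<le> cnt ks p b \<gamma>"
      by metis
    let ?t = "b |` {..<\<gamma>}"
    have tq: "?t \<in> q" using b(3)[OF \<gamma>(2)] .
    have c: "counted ks p ?t (node_len ?t)" using \<gamma>(3) by (simp add: len(1)[OF \<gamma>(2)] counted_restrict)
    have "cnt ks p b \<gamma> < lam" using cnt_le \<gamma>(2) by (rule order_le_less_trans)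
    then have "splitting (ks \<alpha>) p ?t" using \<gamma>(3,4) splitting_mono unfolding counted_def by metis
    then have "{..<ks \<alpha>} \<lesssim> vals p ?t" using splitting_iff[OF p(1)] by simp
    moreover have "vals p ?t \<approx> vals q ?t"
      unfolding q_shrink[OF tq c] using shrink_eqpoll[OF counted_inf[OF bp[OF \<gamma>(2)] c]] by (rule eqpoll_sym)
    ultimately have "splitting (ks \<alpha>) q ?t"
      using splitting_iff[OF q(1)] tq lepoll_trans2 by metis
    moreover have "s \<subseteq>\<^sub>m ?t"
      using map_le_total[OF treeD(3)[OF q(1) s] treeD(3)[OF q(1) tq] b(2) restrict_map_le] len(1)[OF \<gamma>(2)] \<gamma>(1) by simp
    ultimately show "\<exists>t\<in>q. splitting (ks \<alpha>) q t \<and> s \<subseteq>\<^sub>m t" using tq by metis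
  qed
  with q(1,2) sub q_counted q_shrink show thesis by (intro that)
qed

end

lemma map_le_union:
  assumes "\<forall>\<beta> \<xi>. u \<beta> = Some \<xi> \<longleftrightarrow> (\<exists>\<alpha><\<delta>. x \<alpha> \<beta> = Some \<xi>)" "\<alpha> < \<delta>"
  shows "x \<alpha> \<subseteq>\<^sub>m u"
  unfolding map_le_def using assms by (metis domD)

lemma graph_eq_UN_iff:
  "Map.graph u = (\<Union>\<alpha>\<in>A. Map.graph (t \<alpha>)) \<longleftrightarrow> (\<forall>\<beta> \<xi>. u \<beta> = Some \<xi> \<longleftrightarrow> (\<exists>\<alpha>\<in>A. t \<alpha> \<beta> = Some \<xi>))"
  by (auto simp: Map.graph_def set_eq_iff)

section \<open>Splitting-closed trees: restriction, the full tree and thinning\<close>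

context cardinal_sequence
begin

text \<open>The extra clause of \<open>scl_Miller\<close> is isolated so that it can be transferred
  separately from membership in \<open>Miller\<close>. The union is given pointwise, which suits
  arguments about values along a branch.\<close>

definition splitting_closed :: "'o node set \<Rightarrow> bool" where
  "splitting_closed p \<longleftrightarrow> (\<forall>\<delta><lam. is_limit \<delta> \<longrightarrow>
     (\<forall>t. (\<forall>\<alpha><\<delta>. splitting (ks \<alpha>) p (t \<alpha>)) \<and> (\<forall>\<beta><\<delta>. \<forall>\<alpha>\<le>\<beta>. t \<alpha> \<subseteq>\<^sub>m t \<beta>) \<longrightarrow>
        (\<exists>u. (\<forall>\<beta> \<xi>. u \<beta> = Some \<xi> \<longleftrightarrow> (\<exists>\<alpha><\<delta>. t \<alpha> \<beta> = Some \<xi>)) \<and> splitting (ks \<delta>) p u)))"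

lemma splitting_closedD:
  assumes "splitting_closed p" "\<delta> < lam" "is_limit \<delta>"
    "\<forall>\<alpha><\<delta>. splitting (ks \<alpha>) p (t \<alpha>)" "\<forall>\<beta><\<delta>. \<forall>\<alpha>\<le>\<beta>. t \<alpha> \<subseteq>\<^sub>m t \<beta>"
  shows "\<exists>u. (\<forall>\<beta> \<xi>. u \<beta> = Some \<xi> \<longleftrightarrow> (\<exists>\<alpha><\<delta>. t \<alpha> \<beta> = Some \<xi>)) \<and> splitting (ks \<delta>) p u"
  using assms(1)[unfolded splitting_closed_def, rule_format, OF assms(2,3) conjI[OF assms(4,5)]] .

lemma scl_Miller_iff: "p \<in> scl_Miller ks lam \<longleftrightarrow> p \<in> Miller ks lam \<and> splitting_closed p"
  unfolding scl_Miller_def splitting_closed_def graph_eq_UN_iff Bex_def lessThan_iff mem_Collect_eq ..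

lemma Miller_through:
  assumes "p \<in> Miller ks lam" and t: "t \<in> p"
  shows "through p t \<in> Miller ks lam"
proof -
  have p: "is_tree ks lam p" "lt_closed lam p" and ev: "ever_branching ks lam p"
    using assms(1) by (auto simp: Miller_def)
  note th = through_tree[OF p t]
  have "ever_branching ks lam (through p t)"
    unfolding ever_branching_def
  proof (intro ballI allI impI)
    fix s \<alpha> assume s: "s \<in> through p t" and \<alpha>: "\<alpha> < lam"
    \<comment> \<open>\<open>v\<close> is the longer of \<open>s\<close> and \<open>t\<close>. A
      splitting node of \<open>p\<close> above \<open>v\<close> keeps all its successors in
      \<open>through p t\<close>, as it extends \<open>t\<close>.\<close>
    define v where "v = (if t \<subseteq>\<^sub>m s then s else t)"
    have v: "v \<in> p" "s \<subseteq>\<^sub>m v" "t \<subseteq>\<^sub>m v" using s t by (auto simp: v_def through_def)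
    obtain u where u: "u \<in> p" "splitting (ks \<alpha>) p u" "v \<subseteq>\<^sub>m u"
      using ev v(1) \<alpha> unfolding ever_branching_def by metis
    have tu: "t \<subseteq>\<^sub>m u" "s \<subseteq>\<^sub>m u" using v u(3) map_le_trans by metis+
    then have "u \<in> through p t" using u(1) by (simp add: through_def)
    moreover have "splitting (ks \<alpha>) (through p t) u"
      using calculation u(2) th(4)[OF u(1) tu(1)] unfolding splitting_iff[OF p(1)] splitting_iff[OF th(1)] by simp
    ultimately show "\<exists>u\<in>through p t. splitting (ks \<alpha>) (through p t) u \<and> s \<subseteq>\<^sub>m u" using tu(2) by metis
  qed
  with th(1,2) show ?thesis by (simp add: Miller_def)
qed

text \<open>Splitting nodes of \<open>through p t\<close> have infinitely many successors and
  therefore extend \<open>t\<close>, where both trees have the same successors. The union extends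
  \<open>t\<close> too, because a limit \<open>\<delta>\<close> is nonzero.\<close>

lemma splitting_closed_through:
  assumes p: "is_tree ks lam p" "lt_closed lam p" and scl: "splitting_closed p" and t: "t \<in> p"
  shows "splitting_closed (through p t)"
  unfolding splitting_closed_def
proof (intro allI impI; elim conjE)
  fix \<delta> x assume \<delta>: "\<delta> < lam" "is_limit \<delta>"
    and x: "\<forall>\<alpha><\<delta>. splitting (ks \<alpha>) (through p t) (x \<alpha>)" and inc: "\<forall>\<beta><\<delta>. \<forall>\<alpha>\<le>\<beta>. x \<alpha> \<subseteq>\<^sub>m x \<beta>"
  note th = through_tree[OF p t]
  have x': "t \<subseteq>\<^sub>m x \<alpha>" "splitting (ks \<alpha>) p (x \<alpha>)" if \<alpha>: "\<alpha> < \<delta>" for \<alpha>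
  proof -
    have sp: "splitting (ks \<alpha>) (through p t) (x \<alpha>)" using x \<alpha> by simp
    have xt: "x \<alpha> \<in> through p t" using sp by (simp add: splitting_def)
    have "infinite (vals (through p t) (x \<alpha>))" using splitting_infinite[OF th(1) sp] \<alpha> \<delta>(1) by simp
    then show tx: "t \<subseteq>\<^sub>m x \<alpha>" using th(5)[OF xt] by auto
    have "x \<alpha> \<in> p" using xt by (simp add: through_def)
    then show "splitting (ks \<alpha>) p (x \<alpha>)"
      using sp th(4)[OF _ tx] unfolding splitting_iff[OF p(1)] splitting_iff[OF th(1)] by simp
  qed
  then have "\<forall>\<alpha><\<delta>. splitting (ks \<alpha>) p (x \<alpha>)" by simp
  from splitting_closedD[OF scl \<delta> this inc] obtain u where
    u: "\<forall>\<beta> \<xi>. u \<beta> = Some \<xi> \<longleftrightarrow> (\<exists>\<alpha><\<delta>. x \<alpha> \<beta> = Some \<xi>)" "splitting (ks \<delta>) p u"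
    by (elim exE conjE)
  obtain \<alpha> where \<alpha>: "\<alpha> < \<delta>" using \<delta>(2) by (auto simp: is_limit_def)
  have "x \<alpha> \<subseteq>\<^sub>m u" using map_le_union[OF u(1) \<alpha>] .
  then have tu: "t \<subseteq>\<^sub>m u" using x'(1)[OF \<alpha>] map_le_trans by metis
  have up: "u \<in> p" using u(2) by (simp add: splitting_def)
  then have "u \<in> through p t" using tu by (simp add: through_def)
  then have "splitting (ks \<delta>) (through p t) u"
    using u(2) th(4)[OF up tu] unfolding splitting_iff[OF p(1)] splitting_iff[OF th(1)] by simp
  with u(1) show "\<exists>u. (\<forall>\<beta> \<xi>. u \<beta> = Some \<xi> \<longleftrightarrow> (\<exists>\<alpha><\<delta>. x \<alpha> \<beta> = Some \<xi>)) \<and>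
      splitting (ks \<delta>) (through p t) u" by (intro exI[of _ u] conjI)
qed

lemma full_tree_Miller: "nodes ks lam \<in> Miller ks lam"
proof -
  have "ever_branching ks lam (nodes ks lam)"
    unfolding ever_branching_def
  proof (intro ballI allI impI)
    fix s \<alpha> assume s: "s \<in> nodes ks lam" and \<alpha>: "\<alpha> < lam"
    obtain b where b: "dom b = {..<lam}" "s \<subseteq>\<^sub>m b" "\<And>\<beta>. \<beta> < lam \<Longrightarrow> b |` {..<\<beta>} \<in> nodes ks lam"
      using branch_exists[OF full_tree(1,2) s] by metis
    \<comment> \<open>A node of the full tree of length \<open>\<gamma>\<close> has
      \<open>ks \<gamma>\<close> successors, so any level from \<open>\<alpha>\<close> on splits
      enough.\<close>
    define \<gamma> where "\<gamma> = max \<alpha> (node_len s)"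
    have \<gamma>: "\<gamma> < lam" "\<alpha> \<le> \<gamma>" "node_len s \<le> \<gamma>" using \<alpha> nodesD(2)[OF s] by (simp_all add: \<gamma>_def)
    let ?t = "b |` {..<\<gamma>}"
    have t: "?t \<in> nodes ks lam" using b(3)[OF \<gamma>(1)] .
    have len: "node_len ?t = \<gamma>" using dom_restrict_branch(2)[OF b(1)] \<gamma>(1) by simp
    have "splitting (ks \<alpha>) (nodes ks lam) ?t"
      unfolding splitting_iff[OF full_tree(1)] full_tree(3)[OF t] len
      using t ks_lepoll_iff[OF \<alpha> \<gamma>(1)] \<gamma>(2) by simp
    moreover have "s \<subseteq>\<^sub>m ?t" using map_le_total[OF s t b(2) restrict_map_le] len \<gamma>(3) by simp
    ultimately show "\<exists>t\<in>nodes ks lam. splitting (ks \<alpha>) (nodes ks lam) t \<and> s \<subseteq>\<^sub>m t" using t by metis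
  qed
  with full_tree(1,2) show ?thesis by (simp add: Miller_def)
qed

text \<open>In the full tree a node is \<open>ks \<alpha>\<close>-splitting exactly when its length
  is at least \<open>\<alpha>\<close>. So the lengths of the \<open>x \<alpha>\<close> have a
  supremum of at least the limit \<open>\<delta>\<close>, and regularity keeps it below
  \<open>lam\<close>.\<close>

lemma splitting_closed_full_tree: "splitting_closed (nodes ks lam)"
  unfolding splitting_closed_def
proof (intro allI impI; elim conjE)
  fix \<delta> x assume \<delta>: "\<delta> < lam" "is_limit \<delta>"
    and x: "\<forall>\<alpha><\<delta>. splitting (ks \<alpha>) (nodes ks lam) (x \<alpha>)" and inc: "\<forall>\<beta><\<delta>. \<forall>\<alpha>\<le>\<beta>. x \<alpha> \<subseteq>\<^sub>m x \<beta>"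
  have xn: "x \<alpha> \<in> nodes ks lam" if "\<alpha> < \<delta>" for \<alpha> using x that by (simp add: splitting_def)
  have len_lam: "node_len (x \<alpha>) < lam" if "\<alpha> < \<delta>" for \<alpha> using nodesD(2)[OF xn[OF that]] .
  have \<alpha>_le: "\<alpha> \<le> node_len (x \<alpha>)" if \<alpha>: "\<alpha> < \<delta>" for \<alpha>
  proof -
    have "splitting (ks \<alpha>) (nodes ks lam) (x \<alpha>)" using x \<alpha> by simp
    then have "{..<ks \<alpha>} \<lesssim> {..<ks (node_len (x \<alpha>))}"
      unfolding splitting_iff[OF full_tree(1)] full_tree(3)[OF xn[OF \<alpha>]] by simp
    then show ?thesis using ks_lepoll_iff[OF _ len_lam[OF \<alpha>], of \<alpha>] \<alpha> \<delta>(1) by simp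
  qed
  have "x \<alpha> \<subseteq>\<^sub>m x \<beta> \<or> x \<beta> \<subseteq>\<^sub>m x \<alpha>" if "\<alpha> < \<delta>" "\<beta> < \<delta>" for \<alpha> \<beta> using inc that by (meson linear)
  then obtain u where u: "\<forall>y\<in>x ` {..<\<delta>}. y \<subseteq>\<^sub>m u" "dom u = (\<Union>y\<in>x ` {..<\<delta>}. dom y)"
    using chain_union[of "x ` {..<\<delta>}"] by (metis (no_types, lifting) image_iff lessThan_iff)
  have u_iff: "u \<beta> = Some \<xi> \<longleftrightarrow> (\<exists>\<alpha><\<delta>. x \<alpha> \<beta> = Some \<xi>)" for \<beta> \<xi>
  proof
    assume \<xi>: "u \<beta> = Some \<xi>"
    then have "\<beta> \<in> dom u" by (rule domI)
    then obtain \<alpha> where \<alpha>: "\<alpha> < \<delta>" "\<beta> \<in> dom (x \<alpha>)" unfolding u(2) by auto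
    then have "x \<alpha> \<beta> = u \<beta>" using u(1) by (simp add: map_le_def)
    with \<xi> \<alpha>(1) show "\<exists>\<alpha><\<delta>. x \<alpha> \<beta> = Some \<xi>" by metis
  next
    assume "\<exists>\<alpha><\<delta>. x \<alpha> \<beta> = Some \<xi>"
    then obtain \<alpha> where \<alpha>: "\<alpha> < \<delta>" "x \<alpha> \<beta> = Some \<xi>" by metis
    then have "x \<alpha> \<subseteq>\<^sub>m u" using u(1) by simp
    then show "u \<beta> = Some \<xi>" using \<alpha>(2) unfolding map_le_def by (metis domI)
  qed
  obtain \<beta> where \<beta>: "\<beta> < lam" "\<forall>\<alpha><\<delta>. node_len (x \<alpha>) < \<beta>"
    using lam_regular[OF \<delta>(1), of "\<lambda>\<alpha>. node_len (x \<alpha>)"] len_lam by metis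
  then have bd: "\<forall>\<alpha><\<delta>. node_len (x \<alpha>) \<le> \<beta>" by (simp add: less_imp_le)
  define L where "L = (LEAST L. \<forall>\<alpha><\<delta>. node_len (x \<alpha>) \<le> L)"
  have L: "\<forall>\<alpha><\<delta>. node_len (x \<alpha>) \<le> L" unfolding L_def by (rule LeastI) (rule bd)
  have "L \<le> \<beta>" unfolding L_def by (rule Least_le) (rule bd)
  then have L_lam: "L < lam" using \<beta>(1) by simp
  have sup: "\<exists>\<alpha><\<delta>. \<zeta> < node_len (x \<alpha>)" if "\<zeta> < L" for \<zeta>
    using not_less_Least[OF that[unfolded L_def]] by (meson leI)
  have "dom u = (\<Union>\<alpha>\<in>{..<\<delta>}. {..<node_len (x \<alpha>)})" using u(2) nodesD(1)[OF xn] by simp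
  also have "\<dots> = {..<L}"
    unfolding set_eq_iff UN_iff lessThan_iff Bex_def by (metis sup L order_less_le_trans)
  finally have dom_u: "dom u = {..<L}" .
  have "\<xi> < ks \<zeta>" if "u \<zeta> = Some \<xi>" for \<zeta> \<xi> using that u_iff nodesD(3)[OF xn] by metis
  then have un: "u \<in> nodes ks lam" unfolding nodes_def using dom_u L_lam by auto
  have "\<delta> \<le> L"
  proof (rule ccontr)
    assume "\<not> \<delta> \<le> L"
    then have "L < \<delta>" by simp
    then obtain \<gamma> where \<gamma>: "\<gamma> < \<delta>" "L < \<gamma>" using \<delta>(2) by (auto simp: is_limit_def)
    then have "\<gamma> \<le> L" using \<alpha>_le[OF \<gamma>(1)] L by (meson order_trans)
    with \<gamma>(2) show False by simp
  qed
  then have "splitting (ks \<delta>) (nodes ks lam) u"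
    unfolding splitting_iff[OF full_tree(1)] full_tree(3)[OF un] node_len_eq[OF dom_u]
    using un ks_lepoll_iff[OF \<delta>(1) L_lam] by simp
  with u_iff show "\<exists>u. (\<forall>\<beta> \<xi>. u \<beta> = Some \<xi> \<longleftrightarrow> (\<exists>\<alpha><\<delta>. x \<alpha> \<beta> = Some \<xi>)) \<and>
      splitting (ks \<delta>) (nodes ks lam) u" by (intro exI[of _ u] conjI allI)
qed

text \<open>Splitting closure of \<open>p\<close> is applied first to the given sequence, producing
  \<open>u\<close>, and again, if \<open>u\<close> is not one of the \<open>x \<alpha>\<close>, to
  all counted proper initial segments of \<open>u\<close>, enumerated by their counts. The second
  use is needed because being counted demands splitting at the count of \<open>u\<close>, which can
  differ from \<open>\<delta>\<close>.\<close>

lemma splitting_closed_thinning: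
  assumes p: "is_tree ks lam p" and scl: "splitting_closed p"
    and q: "is_tree ks lam q" "lt_closed lam q" and sub: "q \<subseteq> p"
    and cntd: "\<And>t. t \<in> q \<Longrightarrow> infinite (vals q t) \<Longrightarrow> counted ks p t (node_len t)"
    and shr: "\<And>t. t \<in> q \<Longrightarrow> counted ks p t (node_len t) \<Longrightarrow> vals q t = shrink (vals p t)"
  shows "splitting_closed q"
  unfolding splitting_closed_def
proof (intro allI impI; elim conjE)
  fix \<delta> x assume \<delta>: "\<delta> < lam" "is_limit \<delta>"
    and x: "\<forall>\<alpha><\<delta>. splitting (ks \<alpha>) q (x \<alpha>)" and inc: "\<forall>\<beta><\<delta>. \<forall>\<alpha>\<le>\<beta>. x \<alpha> \<subseteq>\<^sub>m x \<beta>"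
  have xq: "x \<alpha> \<in> q" if "\<alpha> < \<delta>" for \<alpha> using x that by (simp add: splitting_def)
  have xn: "x \<alpha> \<in> nodes ks lam" if "\<alpha> < \<delta>" for \<alpha> using treeD(3)[OF q(1) xq[OF that]] .
  have x_counted: "counted ks p (x \<alpha>) (node_len (x \<alpha>))" if \<alpha>: "\<alpha> < \<delta>" for \<alpha>
  proof -
    have "splitting (ks \<alpha>) q (x \<alpha>)" "\<alpha> < lam" using x \<alpha> \<delta>(1) by auto
    from splitting_infinite[OF q(1) this] show ?thesis using cntd[OF xq[OF \<alpha>]] by simp
  qed
  have "splitting (ks \<alpha>) p (x \<alpha>)" if \<alpha>: "\<alpha> < \<delta>" for \<alpha>
  proof -
    have "{..<ks \<alpha>} \<lesssim> vals q (x \<alpha>)" using x \<alpha> unfolding splitting_iff[OF q(1)] by simp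
    moreover have "vals q (x \<alpha>) \<lesssim> vals p (x \<alpha>)"
      using sub by (intro subset_imp_lepoll) (auto simp: vals_def)
    ultimately show ?thesis
      using xq[OF \<alpha>] sub lepoll_trans unfolding splitting_iff[OF p] by (metis subsetD)
  qed
  then have "\<forall>\<alpha><\<delta>. splitting (ks \<alpha>) p (x \<alpha>)" by simp
  from splitting_closedD[OF scl \<delta> this inc] obtain u where
    u: "\<forall>\<beta> \<xi>. u \<beta> = Some \<xi> \<longleftrightarrow> (\<exists>\<alpha><\<delta>. x \<alpha> \<beta> = Some \<xi>)" "splitting (ks \<delta>) p u"
    by (elim exE conjE)
  have up: "u \<in> p" using u(2) by (simp add: splitting_def)
  have un: "u \<in> nodes ks lam" using treeD(3)[OF p up] .
  have xu: "x \<alpha> \<subseteq>\<^sub>m u" if "\<alpha> < \<delta>" for \<alpha> using map_le_union[OF u(1) that] .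
  have "u \<in> q \<and> counted ks p u (node_len u)"
  proof (cases "\<exists>\<alpha><\<delta>. x \<alpha> = u")
    case True
    then show ?thesis using xq x_counted by metis
  next
    case False
    \<comment> \<open>The lengths \<open>l \<alpha>\<close> will be cofinal in the length of
      \<open>u\<close> without attaining it. So that length is a limit, and closure of
      \<open>q\<close> gives \<open>u \<in> q\<close>.\<close>
    define l where "l \<alpha> = node_len (x \<alpha>)" for \<alpha>
    have l_less: "l \<alpha> < node_len u" if \<alpha>: "\<alpha> < \<delta>" for \<alpha>
      using map_le_len(1)[OF xn[OF \<alpha>] un xu[OF \<alpha>]] map_le_len_eq[OF xn[OF \<alpha>] un xu[OF \<alpha>]] False \<alpha>
      unfolding l_def by (metis order_le_imp_less_or_eq)
    have x_eq: "x \<alpha> = u |` {..<l \<alpha>}" if \<alpha>: "\<alpha> < \<delta>" for \<alpha>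
      unfolding l_def using map_le_len(2)[OF xn[OF \<alpha>] un xu[OF \<alpha>]] .
    have sup: "\<exists>\<alpha><\<delta>. \<beta> < l \<alpha>" if \<beta>: "\<beta> < node_len u" for \<beta>
    proof -
      obtain \<xi> where "u \<beta> = Some \<xi>" using \<beta> nodesD(1)[OF un] by (auto simp: dom_def set_eq_iff)
      then obtain \<alpha> where "\<alpha> < \<delta>" "x \<alpha> \<beta> = Some \<xi>" using u(1) by metis
      then show ?thesis using less_len[OF xn] unfolding l_def by metis
    qed
    obtain \<alpha>0 where \<alpha>0: "\<alpha>0 < \<delta>" using \<delta>(2) by (auto simp: is_limit_def)
    have "is_limit (node_len u)"
      unfolding is_limit_def using l_less[OF \<alpha>0] sup l_less by (metis emptyE lessThan_iff)
    moreover have "u |` {..<\<beta>} \<in> q" if "\<beta> < node_len u" for \<beta>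
    proof -
      obtain \<alpha> where \<alpha>: "\<alpha> < \<delta>" "\<beta> < l \<alpha>" using sup \<open>\<beta> < node_len u\<close> by metis
      have "x \<alpha> |` {..<\<beta>} = u |` {..<\<beta>}"
        using restrict_eq_below[OF xn[OF \<alpha>(1)] xu[OF \<alpha>(1)], of \<beta>] \<alpha>(2) unfolding l_def by (simp add: less_imp_le)
      then show ?thesis using treeD(5)[OF q(1) xq[OF \<alpha>(1)], of \<beta>] by simp
    qed
    ultimately have uq: "u \<in> q"
      using q(2) nodesD(1,2)[OF un] unfolding lt_closed_def by metis
    have l_counted: "counted ks p u (l \<alpha>)" if \<alpha>: "\<alpha> < \<delta>" for \<alpha>
      using x_counted[OF \<alpha>] x_eq[OF \<alpha>] counted_restrict(1) unfolding l_def by metis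
    define w where "w = cnt ks p u (node_len u)"
    have w_lam: "w < lam" unfolding w_def using cnt_le nodesD(2)[OF un] by (rule order_le_less_trans)
    have "\<forall>\<xi>. \<exists>\<gamma>. \<xi> < w \<longrightarrow> \<gamma> < node_len u \<and> counted ks p u \<gamma> \<and> cnt ks p u \<gamma> = \<xi>"
      unfolding w_def using cnt_attained by metis
    \<comment> \<open>\<open>g \<xi>\<close> is the counted position of \<open>u\<close> with count
      \<open>\<xi>\<close>; \<open>cnt_attained\<close> provides one for every
      \<open>\<xi> < w\<close>.\<close>
    then obtain g where g: "\<forall>\<xi>. \<xi> < w \<longrightarrow> g \<xi> < node_len u \<and> counted ks p u (g \<xi>) \<and> cnt ks p u (g \<xi>) = \<xi>"
      by (rule choice[THEN exE])
    have cl_w: "cnt ks p u (l \<alpha>) < w" if \<alpha>: "\<alpha> < \<delta>" for \<alpha>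
      unfolding w_def using cnt_less[OF l_less[OF \<alpha>] l_counted[OF \<alpha>]] .
    \<comment> \<open>Beyond every counted position of \<open>u\<close> lies a counted
      \<open>l \<alpha>\<close> that is still below the length of \<open>u\<close>, so no count
      below \<open>w\<close> is the last.\<close>
    have lim_w: "is_limit w"
      unfolding is_limit_def
    proof (intro conjI allI impI)
      show "{..<w} \<noteq> {}" using cl_w[OF \<alpha>0] by auto
      fix \<xi> assume \<xi>: "\<xi> < w"
      then obtain \<alpha> where \<alpha>: "\<alpha> < \<delta>" "g \<xi> < l \<alpha>" using sup g by metis
      then have "\<xi> < cnt ks p u (l \<alpha>)" using cnt_less[OF \<alpha>(2)] g \<xi> by metis
      then show "\<exists>\<gamma><w. \<xi> < \<gamma>" using cl_w[OF \<alpha>(1)] by metis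
    qed
    have split_g: "\<forall>\<xi><w. splitting (ks \<xi>) p (u |` {..<g \<xi>})"
      using g unfolding counted_def by metis
    have "u |` {..<g \<xi>} \<subseteq>\<^sub>m u |` {..<g \<eta>}" if "\<eta> < w" "\<xi> \<le> \<eta>" for \<xi> \<eta>
    proof -
      have "\<xi> < w" using that by simp
      have "g \<xi> \<le> g \<eta>"
      proof (rule ccontr)
        assume "\<not> g \<xi> \<le> g \<eta>"
        then have "g \<eta> < g \<xi>" by simp
        from cnt_less[OF this] show False using g \<open>\<xi> < w\<close> that by (metis leD)
      qed
      then show ?thesis by (intro restrict_mono_le) auto
    qed
    then have "\<forall>\<eta><w. \<forall>\<xi>\<le>\<eta>. u |` {..<g \<xi>} \<subseteq>\<^sub>m u |` {..<g \<eta>}" by simp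
    from splitting_closedD[OF scl w_lam lim_w split_g this] obtain u' where
      u': "\<forall>\<beta> \<xi>. u' \<beta> = Some \<xi> \<longleftrightarrow> (\<exists>\<alpha><w. (u |` {..<g \<alpha>}) \<beta> = Some \<xi>)" "splitting (ks w) p u'"
      by (elim exE conjE)
    \<comment> \<open>The second union is \<open>u\<close> again: by injectivity of the count each
      \<open>l \<alpha>\<close> is some \<open>g \<xi>\<close>, and the \<open>l \<alpha>\<close>
      are cofinal in the length of \<open>u\<close>.\<close>
    have "u' \<beta> = Some \<xi> \<longleftrightarrow> u \<beta> = Some \<xi>" for \<beta> \<xi>
    proof
      assume "u' \<beta> = Some \<xi>"
      then obtain \<alpha> where "(u |` {..<g \<alpha>}) \<beta> = Some \<xi>" using u'(1) by metis
      then show "u \<beta> = Some \<xi>" by (auto simp: restrict_map_def split: if_splits)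
    next
      assume \<xi>: "u \<beta> = Some \<xi>"
      then obtain \<alpha> where \<alpha>: "\<alpha> < \<delta>" "\<beta> < l \<alpha>" using sup less_len[OF un] by metis
      then have "g (cnt ks p u (l \<alpha>)) = l \<alpha>"
        using g cl_w[OF \<alpha>(1)] l_counted[OF \<alpha>(1)] cnt_inj by metis
      then have "(u |` {..<g (cnt ks p u (l \<alpha>))}) \<beta> = Some \<xi>" using \<alpha>(2) \<xi> by simp
      then show "u' \<beta> = Some \<xi>" using u'(1) cl_w[OF \<alpha>(1)] by metis
    qed
    then have "u' = u" by (intro ext option.expand) (metis option.collapse option.distinct(1))+
    then have "counted ks p u (node_len u)"
      unfolding counted_def restrict_len[OF un] w_def[symmetric] using u'(2) by simp
    with uq show ?thesis by simp
  qed
  then have uq: "u \<in> q" and uc: "counted ks p u (node_len u)" by simp_all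
  have "{..<ks \<delta>} \<lesssim> vals p u" using u(2) splitting_iff[OF p] by simp
  moreover have "vals p u \<approx> vals q u"
    unfolding shr[OF uq uc] using shrink_eqpoll[OF splitting_infinite[OF p u(2) \<delta>(1)]] by (rule eqpoll_sym)
  ultimately have "splitting (ks \<delta>) q u"
    using splitting_iff[OF q(1)] uq lepoll_trans2 by metis
  with u(1) show "\<exists>u. (\<forall>\<beta> \<xi>. u \<beta> = Some \<xi> \<longleftrightarrow> (\<exists>\<alpha><\<delta>. x \<alpha> \<beta> = Some \<xi>)) \<and> splitting (ks \<delta>) q u"
    by (intro exI[of _ u] conjI)
qed

lemma Miller_infinite_vals:
  assumes "p \<in> Miller ks lam"
  shows "\<exists>t\<in>p. infinite (vals p t)"
proof -
  have p: "is_tree ks lam p" and ev: "ever_branching ks lam p" using assms by (auto simp: Miller_def)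
  obtain \<alpha> where \<alpha>: "\<alpha> < lam" by (rule lam_pos)
  obtain t where "t \<in> p" "splitting (ks \<alpha>) p t"
    using ev empty_in_tree[OF p] \<alpha> unfolding ever_branching_def by metis
  then show ?thesis using splitting_infinite[OF p _ \<alpha>] by metis
qed

lemma Miller_response:
  assumes "p \<in> Miller ks lam"
  obtains q where "q \<in> Miller ks lam" "q \<subseteq> p" "splitting_closed p \<Longrightarrow> splitting_closed q"
    "\<forall>t\<in>q. infinite (vals q t) \<longrightarrow> vals q t \<subseteq> shrink (vals p t)"
proof -
  have p: "is_tree ks lam p" "lt_closed lam p" and ev: "ever_branching ks lam p"
    using assms by (auto simp: Miller_def)
  obtain q where q: "is_tree ks lam q" "lt_closed lam q" "ever_branching ks lam q" "q \<subseteq> p"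
    and cntd: "\<And>t. t \<in> q \<Longrightarrow> infinite (vals q t) \<Longrightarrow> counted ks p t (node_len t)"
    and shr: "\<And>t. t \<in> q \<Longrightarrow> counted ks p t (node_len t) \<Longrightarrow> vals q t = shrink (vals p t)"
    using thinning[OF p ev] by metis
  show thesis
  proof (rule that)
    show "q \<in> Miller ks lam" using q by (simp add: Miller_def)
    show "splitting_closed q" if "splitting_closed p"
      using splitting_closed_thinning[OF p(1) that q(1,2,4)] cntd shr by metis
    show "\<forall>t\<in>q. infinite (vals q t) \<longrightarrow> vals q t \<subseteq> shrink (vals p t)" using cntd shr by (metis order_refl)
  qed (rule q(4))
qed

section \<open>Conclusions for the two Miller forcings\<close>

lemma Miller_not_distributive:
  "\<not> countably_distributive (Miller ks lam) (\<subseteq>) \<and> adds_new_omega_sequence (Miller ks lam) (\<subseteq>)"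
proof (rule tree_forcing_not_distributive)
  show "Miller ks lam \<noteq> {}" using full_tree_Miller by blast
  show "\<exists>q\<in>Miller ks lam. q \<subseteq> p \<and> (\<forall>t\<in>q. infinite (vals q t) \<longrightarrow> vals q t \<subseteq> shrink (vals p t))"
    if "p \<in> Miller ks lam" for p
    using Miller_response[OF that] by metis
qed (use Miller_through Miller_infinite_vals in \<open>auto simp: Miller_def\<close>)

lemma scl_Miller_not_distributive:
  "\<not> countably_distributive (scl_Miller ks lam) (\<subseteq>) \<and> adds_new_omega_sequence (scl_Miller ks lam) (\<subseteq>)"
proof (rule tree_forcing_not_distributive)
  have "nodes ks lam \<in> scl_Miller ks lam"
    using full_tree_Miller splitting_closed_full_tree by (simp add: scl_Miller_iff)
  then show "scl_Miller ks lam \<noteq> {}" by blast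
  show "\<exists>q\<in>scl_Miller ks lam. q \<subseteq> p \<and> (\<forall>t\<in>q. infinite (vals q t) \<longrightarrow> vals q t \<subseteq> shrink (vals p t))"
    if "p \<in> scl_Miller ks lam" for p
  proof -
    have p: "p \<in> Miller ks lam" "splitting_closed p" using that by (simp_all add: scl_Miller_iff)
    obtain q where q: "q \<in> Miller ks lam" "q \<subseteq> p" "splitting_closed q"
      "\<forall>t\<in>q. infinite (vals q t) \<longrightarrow> vals q t \<subseteq> shrink (vals p t)"
      using Miller_response[OF p(1)] p(2) by metis
    then have "q \<in> scl_Miller ks lam" by (simp add: scl_Miller_iff)
    with q(2,4) show ?thesis by metis
  qed
  fix p assume "p \<in> scl_Miller ks lam"
  then have p: "p \<in> Miller ks lam" "splitting_closed p" by (simp_all add: scl_Miller_iff)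
  then show "is_tree ks lam p" "lt_closed lam p" by (simp_all add: Miller_def)
  then show "through p t \<in> scl_Miller ks lam" if "t \<in> p" for t
    using Miller_through[OF p(1) that] splitting_closed_through[OF _ _ p(2) that] by (simp add: scl_Miller_iff)
  show "\<exists>t\<in>p. infinite (vals p t)" using Miller_infinite_vals[OF p(1)] .
qed

end

text \<open>With a last index \<open>\<beta>\<close> the supremum would be at most
  \<open>ks \<beta> < \<kappa>\<close>, so \<open>lam\<close> is a limit. An unbounded
  \<open>f\<close> from some \<open>\<delta> < lam\<close> to \<open>lam\<close> would compose with
  \<open>ks\<close> to a map cofinal in \<open>\<kappa>\<close>, contradicting the minimality of the
  cofinality.\<close>

lemma cardinal_sequence_cofinal:
  fixes \<kappa> lam :: "'o::wellorder" and ks :: "'o \<Rightarrow> 'o"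
  assumes sing: "singular_cardinal \<kappa>"
    and cof: "cofinality \<kappa> = lam"
    and reg: "\<And>\<alpha>. \<alpha> < lam \<Longrightarrow> regular_cardinal (ks \<alpha>)"
    and mono: "\<And>\<alpha> \<beta>. \<alpha> < \<beta> \<Longrightarrow> \<beta> < lam \<Longrightarrow> ks \<alpha> < ks \<beta>"
    and le: "\<And>\<alpha>. \<alpha> < lam \<Longrightarrow> ks \<alpha> \<le> \<kappa>"
    and sup: "\<And>\<mu>. (\<And>\<alpha>. \<alpha> < lam \<Longrightarrow> ks \<alpha> \<le> \<mu>) \<Longrightarrow> \<kappa> \<le> \<mu>"
  shows "cardinal_sequence ks lam"
proof
  \<comment> \<open>A regular cardinal is not singular, so the bound
    \<open>ks \<alpha> \<le> \<kappa>\<close> is strict.\<close>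
  have less: "ks \<alpha> < \<kappa>" if "\<alpha> < lam" for \<alpha>
    using le[OF that] reg[OF that] sing unfolding regular_cardinal_def singular_cardinal_def
    by (metis less_irrefl order_le_imp_less_or_eq)
  have mono': "ks \<alpha> \<le> ks \<beta>" if "\<alpha> \<le> \<beta>" "\<beta> < lam" for \<alpha> \<beta>
    using mono[of \<alpha> \<beta>] that by (auto simp: order_le_less)
  show "inf_cardinal (ks \<alpha>)" if "\<alpha> < lam" for \<alpha> using reg[OF that] by (simp add: regular_cardinal_def)
  show "ks \<alpha> < ks \<beta>" if "\<alpha> < \<beta>" "\<beta> < lam" for \<alpha> \<beta> using mono that .
  show "is_limit lam"
    unfolding is_limit_def
  proof (intro conjI allI impI)
    show "{..<lam} \<noteq> {}"
    proof
      \<comment> \<open>The supremum of an empty sequence is the least element of the type, which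
        has no predecessors and so is not an infinite cardinal.\<close>
      assume "{..<lam} = {}"
      then have "\<kappa> \<le> \<mu>" for \<mu> using sup[of \<mu>] by auto
      then have "{..<\<kappa>} = {}" by (auto simp: not_less[symmetric])
      with sing show False by (simp add: singular_cardinal_def inf_cardinal_def)
    qed
    fix \<beta> assume \<beta>: "\<beta> < lam"
    show "\<exists>\<gamma><lam. \<beta> < \<gamma>"
    proof (rule ccontr)
      assume "\<not> ?thesis"
      then have "ks \<gamma> \<le> ks \<beta>" if "\<gamma> < lam" for \<gamma> using that mono'[OF _ \<beta>] by (meson leI)
      then have "\<kappa> \<le> ks \<beta>" by (rule sup)
      with less[OF \<beta>] show False by simp
    qed
  qed
  show "\<exists>\<beta><lam. \<forall>i<\<delta>. f i < \<beta>" if \<delta>: "\<delta> < lam" and f: "\<And>i. i < \<delta> \<Longrightarrow> f i < lam" for \<delta> and f :: "'o \<Rightarrow> 'o"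
  proof (rule ccontr)
    assume "\<not> ?thesis"
    then have unb: "\<exists>i<\<delta>. \<beta> \<le> f i" if "\<beta> < lam" for \<beta> using that by (meson leI)
    have "\<exists>i<\<delta>. \<xi> \<le> (ks \<circ> f) i" if \<xi>: "\<xi> < \<kappa>" for \<xi>
    proof -
      obtain \<beta> where \<beta>: "\<beta> < lam" "\<xi> < ks \<beta>" using sup[of \<xi>] \<xi> by (meson leD leI)
      then obtain i where i: "i < \<delta>" "\<beta> \<le> f i" using unb by metis
      then have "ks \<beta> \<le> ks (f i)" using mono' f by simp
      then show ?thesis using i(1) \<beta>(2) by (intro exI[of _ i]) simp
    qed
    moreover have "(ks \<circ> f) ` {..<\<delta>} \<subseteq> {..<\<kappa>}" using less f by auto
    ultimately have cofinal: "\<exists>g. g ` {..<\<delta>} \<subseteq> {..<\<kappa>} \<and> (\<forall>\<xi><\<kappa>. \<exists>i<\<delta>. \<xi> \<le> g i)" by metis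
    have "\<delta> < (LEAST \<gamma>. \<exists>g. g ` {..<\<gamma>} \<subseteq> {..<\<kappa>} \<and> (\<forall>\<xi><\<kappa>. \<exists>\<beta><\<gamma>. \<xi> \<le> g \<beta>))"
      using \<delta> cof by (simp add: cofinality_def)
    from not_less_Least[OF this] cofinal show False by (rule notE)
  qed
qed

theorem theorem4p7:
  fixes \<kappa> lam :: "'o::wellorder" and ks :: "'o \<Rightarrow> 'o" and P :: "'o node set set"
  assumes "singular_cardinal \<kappa>"
    and "cofinality \<kappa> = lam"
    and "\<And>\<alpha>. \<alpha> < lam \<Longrightarrow> regular_cardinal (ks \<alpha>)"
    and "\<And>\<alpha> \<beta>. \<alpha> < \<beta> \<Longrightarrow> \<beta> < lam \<Longrightarrow> ks \<alpha> < ks \<beta>"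
    and "\<And>\<alpha>. \<alpha> < lam \<Longrightarrow> ks \<alpha> \<le> \<kappa>"
    and "\<And>\<mu>. (\<And>\<alpha>. \<alpha> < lam \<Longrightarrow> ks \<alpha> \<le> \<mu>) \<Longrightarrow> \<kappa> \<le> \<mu>"
    and "P = Miller ks lam \<or> P = scl_Miller ks lam \<or> P = Laver ks lam"
  shows "\<not> countably_distributive P (\<subseteq>) \<and> adds_new_omega_sequence P (\<subseteq>)"
proof -
  interpret cardinal_sequence ks lam
    using assms(1-6) by (rule cardinal_sequence_cofinal)
  show ?thesis
    using assms(7) Miller_not_distributive scl_Miller_not_distributive Laver_not_distributive
    by (elim disjE) simp_all
qed

end
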